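(* Let $M\subset G$ be the Cartan model of the symmetric space $G/K$ defined by $\sigma$, let $X\in\mathbb{K}^{n\times n}$ be nonzero, put $\widehat{X}=X^*+\sigma(X)$, and let $A\in\Sigma(h_X^M)$ be a critical point of the height function $h_X^M$. Let $S^M(A)$ be the real vector space $$S^M(A)=\{\beta_0\in T_{A^*}M : A^*\widehat{X}\beta_0+\beta_0\widehat{X}A^*=0\}.$$ Then the generalized Cayley transform induces a diffeomorphism $$c_{A^*}\colon S^M(A)\to\Sigma(h_X^M)\cap\Omega_M(A).$$
   Context: Let $\mathbb{K}$ be one of $\mathbb{R}$, $\mathbb{C}$, $\mathbb{H}$ (quaternions). For a matrix $A\in\mathbb{K}^{n\times n}$, $A^*$ denotes its conjugate transpose. $G$ is the identity component of the compact Lie group $O(n,\mathbb{K})=\{A\in\mathbb{K}^{n\times n}: AA^*=I\}$, i.e. $G=SO(n)$, $U(n)$ or $Sp(n)$. $\sigma\colon G\to G$ is an involutive automorphism which is the restriction of an involutive automorphism $\sigma\colon\mathbb{K}^{n\times n}\to\mathbb{K}^{n\times n}$ of unital (real) algebras satisfying $\sigma(Y^* )=\sigma(Y)^*$ for all $Y\in\mathbb{K}^{n\times n}$. $K=\{B\in G:\sigma(B)=B\}$ is the fixed point subgroup. The Cartan model of $G/K$ is the submanifold $M=\{B\sigma(B)^{-1}: B\in G\}\subset G$, i.e. the image of $G/K\to G$, $[B]\mapsto B\sigma(B)^{-1}$; it is the connected component of the identity of $N=\{B\in G:\sigma(B)=B^{-1}\}$. For $A\in M$ the tangent space, viewed inside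 $\mathbb{K}^{n\times n}$, is $T_AM=\{Y\in\mathbb{K}^{n\times n}: YA^*+AY^*=0,\ \sigma(Y)=Y^*\}$. For $X\in\mathbb{K}^{n\times n}$, $h_X(Y)=\Re\operatorname{Tr}(XY)$ (real part of the trace), $h_X^M$ is its restriction to $M$, and $\Sigma(h_X^M)\subset M$ is the set of critical points of $h_X^M$. For $A\in G$, $\Omega(A)=\{Y\in\mathbb{K}^{n\times n}: A+Y\text{ is invertible}\}$ and the generalized Cayley transform centered at $A$ is the diffeomorphism $c_A\colon\Omega(A)\to\Omega(A^* )$, $c_A(Y)=(I-A^*Y)(A+Y)^{-1}$, with inverse $c_{A^*}$. For $A\in M$, $\Omega_M(A)=\Omega(A)\cap M$. *)

theory Defs
  imports "HOL-Analysis.Analysis"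
begin

section \<open>Quaternions\<close>

datatype quat = Quat (qRe: real) (qIm1: real) (qIm2: real) (qIm3: real)

lemma quat_eq_iff:
  "x = y \<longleftrightarrow> qRe x = qRe y \<and> qIm1 x = qIm1 y \<and> qIm2 x = qIm2 y \<and> qIm3 x = qIm3 y"
  by (cases x; cases y) simp

instantiation quat :: ab_group_add
begin
definition "0 = Quat 0 0 0 0"
definition "x + y = Quat (qRe x + qRe y) (qIm1 x + qIm1 y) (qIm2 x + qIm2 y) (qIm3 x + qIm3 y)"
definition "- x = Quat (- qRe x) (- qIm1 x) (- qIm2 x) (- qIm3 x)"
definition "x - y = Quat (qRe x - qRe y) (qIm1 x - qIm1 y) (qIm2 x - qIm2 y) (qIm3 x - qIm3 y)"
instance
  by standard (simp_all add: quat_eq_iff zero_quat_def plus_quat_def uminus_quat_def minus_quat_def)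
end

lemma quat_add_simps [simp]:
  "qRe 0 = 0" "qIm1 0 = 0" "qIm2 0 = 0" "qIm3 0 = 0"
  "qRe (x + y) = qRe x + qRe y" "qIm1 (x + y) = qIm1 x + qIm1 y"
  "qIm2 (x + y) = qIm2 x + qIm2 y" "qIm3 (x + y) = qIm3 x + qIm3 y"
  "qRe (- x) = - qRe x" "qIm1 (- x) = - qIm1 x" "qIm2 (- x) = - qIm2 x" "qIm3 (- x) = - qIm3 x"
  "qRe (x - y) = qRe x - qRe y" "qIm1 (x - y) = qIm1 x - qIm1 y"
  "qIm2 (x - y) = qIm2 x - qIm2 y" "qIm3 (x - y) = qIm3 x - qIm3 y"
  by (simp_all add: zero_quat_def plus_quat_def uminus_quat_def minus_quat_def)

instantiation quat :: ring_1
begin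
definition "1 = Quat 1 0 0 0"
definition "x * y = Quat
  (qRe x * qRe y - qIm1 x * qIm1 y - qIm2 x * qIm2 y - qIm3 x * qIm3 y)
  (qRe x * qIm1 y + qIm1 x * qRe y + qIm2 x * qIm3 y - qIm3 x * qIm2 y)
  (qRe x * qIm2 y - qIm1 x * qIm3 y + qIm2 x * qRe y + qIm3 x * qIm1 y)
  (qRe x * qIm3 y + qIm1 x * qIm2 y - qIm2 x * qIm1 y + qIm3 x * qRe y)"
instance
  by standard (simp_all add: quat_eq_iff one_quat_def times_quat_def algebra_simps)
end

lemma quat_mult_simps [simp]:
  "qRe 1 = 1" "qIm1 1 = 0" "qIm2 1 = 0" "qIm3 1 = 0"
  "qRe (x * y) = qRe x * qRe y - qIm1 x * qIm1 y - qIm2 x * qIm2 y - qIm3 x * qIm3 y"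
  "qIm1 (x * y) = qRe x * qIm1 y + qIm1 x * qRe y + qIm2 x * qIm3 y - qIm3 x * qIm2 y"
  "qIm2 (x * y) = qRe x * qIm2 y - qIm1 x * qIm3 y + qIm2 x * qRe y + qIm3 x * qIm1 y"
  "qIm3 (x * y) = qRe x * qIm3 y + qIm1 x * qIm2 y - qIm2 x * qIm1 y + qIm3 x * qRe y"
  by (simp_all add: one_quat_def times_quat_def)

instantiation quat :: real_algebra_1
begin
definition "scaleR (r::real) x = Quat (r * qRe x) (r * qIm1 x) (r * qIm2 x) (r * qIm3 x)"
instance
  by standard (simp_all add: quat_eq_iff scaleR_quat_def algebra_simps)
end

lemma quat_scaleR_simps [simp]:
  "qRe (r *\<^sub>R x) = r * qRe x" "qIm1 (r *\<^sub>R x) = r * qIm1 x"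
  "qIm2 (r *\<^sub>R x) = r * qIm2 x" "qIm3 (r *\<^sub>R x) = r * qIm3 x"
  by (simp_all add: scaleR_quat_def)

lemma quat_of_real_simps [simp]:
  "qRe (of_real r) = r" "qIm1 (of_real r) = 0" "qIm2 (of_real r) = 0" "qIm3 (of_real r) = 0"
  by (simp_all add: of_real_def)

instantiation quat :: real_inner
begin
definition "inner x y = qRe x * qRe y + qIm1 x * qIm1 y + qIm2 x * qIm2 y + qIm3 x * qIm3 y"
definition "norm (x::quat) = sqrt (inner x x)"
definition "sgn (x::quat) = x /\<^sub>R norm x"
definition "dist (x::quat) y = norm (x - y)"
definition "(uniformity :: (quat \<times> quat) filter) = (INF e\<in>{0<..}. principal {(x, y). dist x y < e})"
definition "open (U::quat set) \<longleftrightarrow> (\<forall>x\<in>U. eventually (\<lambda>(x', y). x' = x \<longrightarrow> y \<in> U) uniformity)"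
instance
proof
  fix x y z :: quat and r :: real and S :: "quat set"
  show "dist x y = norm (x - y)" by (rule dist_quat_def)
  show "sgn x = x /\<^sub>R norm x" by (rule sgn_quat_def)
  show "(uniformity :: (quat \<times> quat) filter) = (INF e\<in>{0<..}. principal {(x, y). dist x y < e})"
    by (rule uniformity_quat_def)
  show "open S \<longleftrightarrow> (\<forall>x\<in>S. eventually (\<lambda>(x', y). x' = x \<longrightarrow> y \<in> S) uniformity)"
    by (rule open_quat_def)
  show "inner x y = inner y x" by (simp add: inner_quat_def mult.commute)
  show "inner (x + y) z = inner x z + inner y z" by (simp add: inner_quat_def algebra_simps)
  show "inner (r *\<^sub>R x) y = r * inner x y" by (simp add: inner_quat_def algebra_simps)
  show "0 \<le> inner x x" by (simp add: inner_quat_def)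
  show "inner x x = 0 \<longleftrightarrow> x = 0"
    by (simp add: inner_quat_def quat_eq_iff add_nonneg_eq_0_iff)
  show "norm x = sqrt (inner x x)" by (rule norm_quat_def)
qed
end

instantiation quat :: euclidean_space
begin
definition "Basis = {Quat 1 0 0 0, Quat 0 1 0 0, Quat 0 0 1 0, Quat 0 0 0 1}"
instance
proof
  show "(Basis :: quat set) \<noteq> {}" "finite (Basis :: quat set)"
    by (simp_all add: Basis_quat_def)
  show "inner u v = (if u = v then 1 else 0)" if "u \<in> Basis" "v \<in> Basis" for u v :: quat
    using that unfolding Basis_quat_def by (elim insertE emptyE) (simp_all add: inner_quat_def)
  show "(\<forall>u\<in>Basis. inner x u = 0) \<longleftrightarrow> x = 0" for x :: quat
    unfolding Basis_quat_def quat_eq_iff by (simp add: inner_quat_def)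
qed
end

definition qcnj :: "quat \<Rightarrow> quat" where
  "qcnj x = Quat (qRe x) (- qIm1 x) (- qIm2 x) (- qIm3 x)"

lemma qcnj_simps [simp]:
  "qRe (qcnj x) = qRe x" "qIm1 (qcnj x) = - qIm1 x" "qIm2 (qcnj x) = - qIm2 x" "qIm3 (qcnj x) = - qIm3 x"
  by (simp_all add: qcnj_def)

lemma qcnj_mult: "qcnj (x * y) = qcnj y * qcnj x"
  by (simp add: quat_eq_iff algebra_simps)

lemma quat_norm_sq: "(norm (x::quat))\<^sup>2 = (qRe x)\<^sup>2 + (qIm1 x)\<^sup>2 + (qIm2 x)\<^sup>2 + (qIm3 x)\<^sup>2"
  by (simp add: norm_quat_def inner_quat_def power2_eq_square)

lemma quat_mult_qcnj: "x * qcnj x = of_real ((norm x)\<^sup>2)"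
  unfolding quat_eq_iff quat_of_real_simps quat_norm_sq
  by (simp add: power2_eq_square)

lemma quat_qcnj_mult: "qcnj x * x = of_real ((norm x)\<^sup>2)"
  unfolding quat_eq_iff quat_of_real_simps quat_norm_sq
  by (simp add: power2_eq_square)

instantiation quat :: real_normed_div_algebra
begin
definition "inverse (x::quat) = qcnj x /\<^sub>R (norm x)\<^sup>2"
definition "x div (y::quat) = x * (qcnj y /\<^sub>R (norm y)\<^sup>2)"
instance
proof
  fix x y :: quat
  show "inverse (0::quat) = 0" by (simp add: inverse_quat_def quat_eq_iff)
  show "x div y = x * inverse y" by (simp add: divide_quat_def inverse_quat_def)
  show "inverse x * x = 1" if "x \<noteq> 0"
    using that unfolding inverse_quat_def mult_scaleR_left quat_qcnj_mult of_real_def by simp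
  show "x * inverse x = 1" if "x \<noteq> 0"
    using that unfolding inverse_quat_def mult_scaleR_right quat_mult_qcnj of_real_def by simp
  have "(of_real ((norm (x * y))\<^sup>2) :: quat) = x * (y * qcnj y) * qcnj x"
    unfolding quat_mult_qcnj[symmetric] qcnj_mult by (simp only: mult.assoc)
  also have "\<dots> = of_real ((norm y)\<^sup>2) * (x * qcnj x)"
    unfolding quat_mult_qcnj[of y] by (simp only: of_real_def mult_scaleR_left mult_scaleR_right mult_1_left mult_1_right)
  also have "\<dots> = of_real ((norm x * norm y)\<^sup>2)"
    unfolding quat_mult_qcnj[of x] power_mult_distrib of_real_mult[symmetric] by (simp only: mult.commute)
  finally have "(norm (x * y))\<^sup>2 = (norm x * norm y)\<^sup>2"
    by (simp only: of_real_eq_iff)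
  then show "norm (x * y) = norm x * norm y"
    by (rule power2_eq_imp_eq) simp_all
qed
end

section \<open>The scalars: real numbers, complex numbers, quaternions\<close>

text \<open>
  Finite-dimensional associative real division algebras with a multiplicative Euclidean norm and
  conjugation. The instances below are the real numbers, the complex numbers and the quaternions
  with their usual conjugation and real part; by the Frobenius theorem these are, up to
  isomorphism, the only ones (the last axiom forces the conjugation to be the usual one).
\<close>

class rch = real_normed_div_algebra + euclidean_space +
  fixes kcnj :: "'a \<Rightarrow> 'a"
    and kRe :: "'a \<Rightarrow> real"
  assumes kcnj_add: "kcnj (x + y) = kcnj x + kcnj y"
    and kcnj_scaleR: "kcnj (r *\<^sub>R x) = r *\<^sub>R kcnj x"
    and kcnj_mult: "kcnj (x * y) = kcnj y * kcnj x"
    and kcnj_kcnj: "kcnj (kcnj x) = x"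
    and add_kcnj: "x + kcnj x = (2 * kRe x) *\<^sub>R 1"
    and mult_kcnj: "x * kcnj x = (norm x)\<^sup>2 *\<^sub>R 1"

instantiation real :: rch
begin
definition "kcnj (x::real) = x"
definition "kRe (x::real) = x"
instance
  by standard (simp_all add: kcnj_real_def kRe_real_def power2_eq_square)
end

instantiation complex :: rch
begin
definition "kcnj (z::complex) = cnj z"
definition "kRe (z::complex) = Re z"
instance
proof
  fix z :: complex
  show "z + kcnj z = (2 * kRe z) *\<^sub>R 1"
    by (simp add: kcnj_complex_def kRe_complex_def complex_eq_iff)
  show "z * kcnj z = (norm z)\<^sup>2 *\<^sub>R 1"
    unfolding kcnj_complex_def complex_norm_square[symmetric] by (simp add: scaleR_conv_of_real)
qed (simp_all add: kcnj_complex_def)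
end

instantiation quat :: rch
begin
definition "kcnj (x::quat) = qcnj x"
definition "kRe (x::quat) = qRe x"
instance
proof
  fix x :: quat
  show "x * kcnj x = (norm x)\<^sup>2 *\<^sub>R 1"
    unfolding kcnj_quat_def of_real_def[symmetric] by (rule quat_mult_qcnj)
qed (simp_all add: kcnj_quat_def kRe_quat_def quat_eq_iff)
end

section \<open>Smooth maps between subsets of Euclidean spaces\<close>

text \<open>Meaningful for open \<open>U\<close>: all partial derivatives of \<open>f\<close> up to order \<open>k\<close> exist and are
  continuous on \<open>U\<close>.\<close>

primrec Ck_on :: "nat \<Rightarrow> 'a::real_normed_vector set \<Rightarrow> ('a \<Rightarrow> 'b::real_normed_vector) \<Rightarrow> bool" where
  "Ck_on 0 U f \<longleftrightarrow> continuous_on U f"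
| "Ck_on (Suc k) U f \<longleftrightarrow>
    (\<forall>x\<in>U. f differentiable (at x)) \<and> (\<forall>v. Ck_on k U (\<lambda>x. frechet_derivative f (at x) v))"

text \<open>On an arbitrary subset, smooth means locally extendable to a smooth map on an open set. For
  embedded submanifolds this is the usual notion of smooth map.\<close>

definition smooth_map_on :: "'a::real_normed_vector set \<Rightarrow> ('a \<Rightarrow> 'b::real_normed_vector) \<Rightarrow> bool" where
  "smooth_map_on S f \<longleftrightarrow>
    (\<forall>x\<in>S. \<exists>U g. open U \<and> x \<in> U \<and> (\<forall>k. Ck_on k U g) \<and> (\<forall>y\<in>S \<inter> U. g y = f y))"

definition diffeomorphism ::
  "'a::real_normed_vector set \<Rightarrow> 'b::real_normed_vector set \<Rightarrow> ('a \<Rightarrow> 'b) \<Rightarrow> bool" where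
  "diffeomorphism S T f \<longleftrightarrow>
    bij_betw f S T \<and> smooth_map_on S f \<and> smooth_map_on T (inv_into S f)"

definition smooth_curve_at :: "'a::real_normed_vector set \<Rightarrow> 'a \<Rightarrow> (real \<Rightarrow> 'a) \<Rightarrow> bool" where
  "smooth_curve_at M p \<gamma> \<longleftrightarrow>
    \<gamma> 0 = p \<and> (\<exists>e>0. smooth_map_on {-e<..<e} \<gamma> \<and> \<gamma> ` {-e<..<e} \<subseteq> M)"

definition tangent_space :: "'a::real_normed_vector set \<Rightarrow> 'a \<Rightarrow> 'a set" where
  "tangent_space M p = {v. \<exists>\<gamma>. smooth_curve_at M p \<gamma> \<and> (\<gamma> has_vector_derivative v) (at 0)}"

text \<open>Critical points of the restriction of \<open>f\<close> to \<open>M\<close>: only the values of \<open>f\<close> on \<open>M\<close> matter.\<close>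

definition critical_points :: "('a::real_normed_vector \<Rightarrow> real) \<Rightarrow> 'a set \<Rightarrow> 'a set" where
  "critical_points f M =
    {p \<in> M. \<forall>\<gamma>. smooth_curve_at M p \<gamma> \<longrightarrow> ((\<lambda>t. f (\<gamma> t)) has_real_derivative 0) (at 0)}"

section \<open>Cartan models, height functions and Cayley transforms\<close>

definition ctranspose :: "'a::rch^'n^'m \<Rightarrow> 'a^'m^'n" where
  "ctranspose A = (\<chi> i j. kcnj (A $ j $ i))"

definition O_group :: "('a::rch^'n^'n) set" where
  "O_group = {A. A ** ctranspose A = mat 1}"

definition G_group :: "('a::rch^'n^'n) set" where
  "G_group = connected_component_set O_group (mat 1)"

text \<open>Such a \<open>\<sigma>\<close> maps \<open>G_group\<close> onto itself: it preserves \<open>O_group\<close>, is continuous and fixes the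
  identity matrix.\<close>

definition involutive_star_automorphism :: "('a::rch^'n^'n \<Rightarrow> 'a^'n^'n) \<Rightarrow> bool" where
  "involutive_star_automorphism \<sigma> \<longleftrightarrow>
    linear \<sigma> \<and> \<sigma> (mat 1) = mat 1 \<and> (\<forall>A B. \<sigma> (A ** B) = \<sigma> A ** \<sigma> B) \<and>
    (\<forall>A. \<sigma> (\<sigma> A) = A) \<and> (\<forall>A. \<sigma> (ctranspose A) = ctranspose (\<sigma> A))"

definition cartan_model :: "('a::rch^'n^'n \<Rightarrow> 'a^'n^'n) \<Rightarrow> ('a^'n^'n) set" where
  "cartan_model \<sigma> = {B ** matrix_inv (\<sigma> B) | B. B \<in> G_group}"

definition height :: "'a::rch^'n^'n \<Rightarrow> 'a^'n^'n \<Rightarrow> real" where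
  "height X Y = kRe (trace (X ** Y))"

definition Omega :: "'a::rch^'n^'n \<Rightarrow> ('a^'n^'n) set" where
  "Omega A = {Y. invertible (A + Y)}"

definition cayley :: "'a::rch^'n^'n \<Rightarrow> 'a^'n^'n \<Rightarrow> 'a^'n^'n" where
  "cayley A Y = (mat 1 - ctranspose A ** Y) ** matrix_inv (A + Y)"

definition X_hat :: "('a::rch^'n^'n \<Rightarrow> 'a^'n^'n) \<Rightarrow> 'a^'n^'n \<Rightarrow> 'a^'n^'n" where
  "X_hat \<sigma> X = ctranspose X + \<sigma> X"

definition S_space :: "('a::rch^'n^'n \<Rightarrow> 'a^'n^'n) \<Rightarrow> 'a^'n^'n \<Rightarrow> 'a^'n^'n \<Rightarrow> ('a^'n^'n) set" where
  "S_space \<sigma> X A =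
    {\<beta> \<in> tangent_space (cartan_model \<sigma>) (ctranspose A).
      ctranspose A ** X_hat \<sigma> X ** \<beta> + \<beta> ** X_hat \<sigma> X ** ctranspose A = 0}"

end

theory Submission imports Defs begin

text \<open>
  Write \<open>\<beta> = A\<^sup>* S\<close>. Tangent vectors of \<open>M\<close> at \<open>A\<^sup>*\<close> correspond to skew matrices \<open>S\<close> with
  \<open>A \<sigma>(S) A\<^sup>* = - S\<close>, and the Cayley transform becomes \<open>cay S A\<close> with
  \<open>cay S = (1 - S) (1 + S)\<^sup>-\<^sup>1\<close>, an involution wherever it is defined. A point \<open>P\<close> of \<open>M\<close> is critical
  iff \<open>X_hat P\<^sup>*\<close> is Hermitian; with the Hermitian matrix \<open>H = X_hat A\<^sup>*\<close> this reads
  \<open>H cay (- S) = cay S H\<close> for \<open>P = cay S A\<close>, and applying \<open>cay\<close> once more turns it into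
  \<open>- H S = S H\<close>. That \<open>cay S A\<close> lies in \<open>M\<close> itself, and not only among the \<open>Q\<close> in \<open>O(n, K)\<close> with
  \<open>\<sigma>(Q) = Q\<^sup>*\<close>, follows for small \<open>S\<close> by writing \<open>cay S = (cay U)\<^sup>2\<close>, which gives
  \<open>cay S A = cay U A \<sigma>(cay U)\<^sup>-\<^sup>1\<close>, and for all \<open>S\<close> by connectedness of the line through \<open>S\<close>.
\<close>

section \<open>Real inner product and norm on matrices\<close>

lemma kRe_eqI: "x + kcnj x = (2 * r) *\<^sub>R 1 \<Longrightarrow> kRe (x::'a::rch) = r"
  by (simp add: add_kcnj)

lemma kRe_0 [simp]: "kRe (0::'a::rch) = 0"
  using kcnj_scaleR[of 0 "0::'a"] by (intro kRe_eqI) simp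

lemma kRe_add: "kRe (x + y) = kRe x + kRe (y::'a::rch)"
proof (rule kRe_eqI)
  have "x + y + kcnj (x + y) = (x + kcnj x) + (y + kcnj y)" by (simp add: kcnj_add)
  then show "x + y + kcnj (x + y) = (2 * (kRe x + kRe y)) *\<^sub>R 1"
    by (simp add: add_kcnj scaleR_add_left algebra_simps)
qed

lemma kRe_sum: "kRe (sum f I) = (\<Sum>i\<in>I. kRe (f i :: 'a::rch))"
  by (induction I rule: infinite_finite_induct) (simp_all add: kRe_add)

text \<open>The axioms tie conjugation to the norm only; expanding
  \<open>(x + y) * kcnj (x + y)\<close> and polarizing recovers the inner product.\<close>

lemma inner_eq_kRe: "inner x y = kRe (x * kcnj (y::'a::rch))"
proof (rule kRe_eqI[symmetric])
  have "(x + y) * kcnj (x + y) = x * kcnj x + y * kcnj y + (x * kcnj y + kcnj (x * kcnj y))"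
    by (simp add: kcnj_add kcnj_mult kcnj_kcnj algebra_simps)
  then have "x * kcnj y + kcnj (x * kcnj y) = ((norm (x + y))\<^sup>2 - (norm x)\<^sup>2 - (norm y)\<^sup>2) *\<^sub>R 1"
    by (simp add: mult_kcnj algebra_simps)
  then show "x * kcnj y + kcnj (x * kcnj y) = (2 * inner x y) *\<^sub>R 1"
    by (simp add: power2_norm_eq_inner inner_add_left inner_add_right inner_commute)
qed

lemma norm_kcnj: "norm (kcnj x) = norm (x::'a::rch)"
proof (cases "x = 0")
  case True
  then show ?thesis using kcnj_scaleR[of 0 x] by simp
next
  case False
  have "norm x * norm (kcnj x) = norm x * norm x"
    unfolding norm_mult[symmetric] mult_kcnj by (simp add: power2_eq_square norm_mult)
  with False show ?thesis by simp
qed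

lemma inner_kcnj: "inner (kcnj x) (kcnj y) = inner x (y::'a::rch)"
  by (simp add: dot_norm kcnj_add[symmetric] norm_kcnj)

lemma inner_mult_right_kcnj: "inner (x * y) z = inner x (z * kcnj (y::'a::rch))"
  by (simp add: inner_eq_kRe kcnj_mult kcnj_kcnj mult.assoc)

text \<open>Conjugation is an isometry that reverses products, which reduces left multiplication to
  right multiplication.\<close>

lemma inner_mult_left_kcnj: "inner (x * y) z = inner y (kcnj x * (z::'a::rch))"
proof -
  have "inner (x * y) z = inner (kcnj y * kcnj x) (kcnj z)"
    by (simp add: inner_kcnj flip: kcnj_mult)
  also have "\<dots> = inner (kcnj y) (kcnj (kcnj x * z))"
    by (simp add: inner_mult_right_kcnj kcnj_mult)
  finally show ?thesis by (simp only: inner_kcnj)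
qed

lemma inner_vec_vec: "inner (A::'a::real_inner^'n^'m) B = (\<Sum>i\<in>UNIV. \<Sum>j\<in>UNIV. inner (A$i$j) (B$i$j))"
  by (simp add: inner_vec_def)

text \<open>Turns the height function into a linear functional on a Euclidean space, so that
  critical points can be studied with adjoints instead of traces.\<close>

lemma height_eq_inner: "height X Y = inner Y (ctranspose X)"
proof -
  have "height X Y = (\<Sum>i\<in>UNIV. \<Sum>k\<in>UNIV. inner (X$i$k) (kcnj (Y$k$i)))"
    by (simp add: height_def trace_def matrix_matrix_mult_def kRe_sum inner_eq_kRe kcnj_kcnj)
  also have "\<dots> = (\<Sum>i\<in>UNIV. \<Sum>k\<in>UNIV. inner (Y$k$i) (kcnj (X$i$k)))"
    by (subst inner_kcnj[symmetric]) (simp add: kcnj_kcnj inner_commute)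
  also have "\<dots> = inner Y (ctranspose X)"
    unfolding inner_vec_vec ctranspose_def by (subst sum.swap) simp
  finally show ?thesis .
qed

lemma norm_matrix_power2:
  "(norm (A::'a::real_inner^'n^'m))\<^sup>2 = (\<Sum>i\<in>UNIV. \<Sum>j\<in>UNIV. (norm (A$i$j))\<^sup>2)"
  by (simp add: power2_norm_eq_inner inner_vec_vec)

text \<open>The Euclidean norm of a matrix is its Frobenius norm, so this is Cauchy-Schwarz for each
  row and column.\<close>

lemma norm_matrix_mult_le: "norm (A ** B) \<le> norm A * norm (B::'a::rch^'p^'n)"
proof (rule power2_le_imp_le)
  have *: "(norm ((A ** B)$i$k))\<^sup>2 \<le> (\<Sum>j\<in>UNIV. (norm (A$i$j))\<^sup>2) * (\<Sum>j\<in>UNIV. (norm (B$j$k))\<^sup>2)" for i k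
  proof -
    have "norm ((A ** B)$i$k) \<le> (\<Sum>j\<in>UNIV. norm (A$i$j) * norm (B$j$k))"
      unfolding matrix_matrix_mult_def by (simp add: sum_norm_le norm_mult)
    then have "(norm ((A ** B)$i$k))\<^sup>2 \<le> (\<Sum>j\<in>UNIV. norm (A$i$j) * norm (B$j$k))\<^sup>2"
      by (intro power_mono) auto
    also have "\<dots> \<le> (\<Sum>j\<in>UNIV. (norm (A$i$j))\<^sup>2) * (\<Sum>j\<in>UNIV. (norm (B$j$k))\<^sup>2)"
      by (rule Cauchy_Schwarz_ineq_sum)
    finally show ?thesis .
  qed
  have "(norm (A ** B))\<^sup>2 \<le>
      (\<Sum>i\<in>UNIV. \<Sum>k\<in>UNIV. (\<Sum>j\<in>UNIV. (norm (A$i$j))\<^sup>2) * (\<Sum>j\<in>UNIV. (norm (B$j$k))\<^sup>2))"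
    unfolding norm_matrix_power2[of "A ** B"] by (intro sum_mono *)
  also have "\<dots> = (\<Sum>i\<in>UNIV. \<Sum>j\<in>UNIV. (norm (A$i$j))\<^sup>2) * (\<Sum>k\<in>UNIV. \<Sum>j\<in>UNIV. (norm (B$j$k))\<^sup>2)"
    by (simp only: sum_product)
  also have "\<dots> = (norm A * norm B)\<^sup>2"
    unfolding power_mult_distrib norm_matrix_power2 by (subst (2) sum.swap) simp
  finally show "(norm (A ** B))\<^sup>2 \<le> (norm A * norm B)\<^sup>2" .
qed simp

lemma bounded_bilinear_matrix_mult:
  "bounded_bilinear ((**) :: 'a::rch^'n^'m \<Rightarrow> 'a^'p^'n \<Rightarrow> 'a^'p^'m)"
proof
  fix A A' :: "'a^'n^'m" and B B' :: "'a^'p^'n" and r :: real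
  show "(A + A') ** B = A ** B + A' ** B"
    by (vector matrix_matrix_mult_def sum.distrib[symmetric] distrib_right)
  show "A ** (B + B') = A ** B + A ** B'" by (rule matrix_add_ldistrib)
  show "(r *\<^sub>R A) ** B = r *\<^sub>R (A ** B)" "A ** (r *\<^sub>R B) = r *\<^sub>R (A ** B)"
    by (simp_all add: vec_eq_iff matrix_matrix_mult_def scaleR_sum_right)
  show "\<exists>K. \<forall>A B. norm ((A::'a^'n^'m) ** (B::'a^'p^'n)) \<le> norm A * norm B * K"
    using norm_matrix_mult_le by (intro exI[of _ 1]) auto
qed

interpretation matrix_mult: bounded_bilinear "(**) :: 'a::rch^'n^'m \<Rightarrow> 'a^'p^'n \<Rightarrow> 'a^'p^'m"
  by (rule bounded_bilinear_matrix_mult)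

lemmas matrix_ring_simps = matrix_mul_assoc matrix_mult.add_left matrix_mult.add_right
  matrix_mult.diff_left matrix_mult.diff_right matrix_mult.minus_left matrix_mult.minus_right
  matrix_mult.scaleR_left matrix_mult.scaleR_right

section \<open>Conjugate transposes as adjoints\<close>

lemma ctranspose_ctranspose [simp]: "ctranspose (ctranspose A) = A"
  by (simp add: ctranspose_def kcnj_kcnj vec_eq_iff)

lemma kcnj_0 [simp]: "kcnj (0::'a::rch) = 0"
  using kcnj_scaleR[of 0 "0::'a"] by simp

lemma kcnj_1 [simp]: "kcnj (1::'a::rch) = 1"
  using kcnj_mult[of 1 "kcnj (1::'a)"] by (simp add: kcnj_kcnj)

lemma kcnj_sum: "kcnj (sum f I) = (\<Sum>i\<in>I. kcnj (f i :: 'a::rch))"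
  by (induction I rule: infinite_finite_induct) (simp_all add: kcnj_add)

lemma ctranspose_mat_1 [simp]: "ctranspose (mat 1) = (mat 1 :: 'a::rch^'n^'n)"
  by (simp add: ctranspose_def mat_def vec_eq_iff)

lemma ctranspose_mult: "ctranspose (A ** B) = ctranspose B ** ctranspose A"
  by (simp add: ctranspose_def matrix_matrix_mult_def vec_eq_iff kcnj_sum kcnj_mult)

lemma inner_ctranspose: "inner (ctranspose A) (ctranspose B) = inner A B"
  unfolding inner_vec_vec ctranspose_def by (subst sum.swap) (simp add: inner_kcnj)

lemma norm_ctranspose: "norm (ctranspose A) = norm A"
  by (simp add: norm_eq_sqrt_inner inner_ctranspose)

lemma bounded_linear_ctranspose: "bounded_linear (ctranspose :: 'a::rch^'n^'m \<Rightarrow> 'a^'m^'n)"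
  by (rule bounded_linear_intro[where K = 1])
    (simp_all add: norm_ctranspose, simp_all add: ctranspose_def vec_eq_iff kcnj_add kcnj_scaleR)

lemmas ctranspose_linear_simps = linear_add[OF bounded_linear.linear[OF bounded_linear_ctranspose]]
  linear_diff[OF bounded_linear.linear[OF bounded_linear_ctranspose]]
  linear_neg[OF bounded_linear.linear[OF bounded_linear_ctranspose]]
  linear_cmul[OF bounded_linear.linear[OF bounded_linear_ctranspose]]

lemma inner_matrix_mult_left: "inner (A ** B) C = inner B (ctranspose A ** C)"
proof -
  have "inner (A ** B) C = (\<Sum>i\<in>UNIV. \<Sum>k\<in>UNIV. \<Sum>j\<in>UNIV. inner (A$i$j * B$j$k) (C$i$k))"
    by (simp add: inner_vec_vec matrix_matrix_mult_def inner_sum_left)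
  also have "\<dots> = (\<Sum>i\<in>UNIV. \<Sum>k\<in>UNIV. \<Sum>j\<in>UNIV. inner (B$j$k) (kcnj (A$i$j) * C$i$k))"
    by (simp add: inner_mult_left_kcnj)
  also have "\<dots> = (\<Sum>k\<in>UNIV. \<Sum>j\<in>UNIV. \<Sum>i\<in>UNIV. inner (B$j$k) (kcnj (A$i$j) * C$i$k))"
    by (subst sum.swap, intro sum.cong refl, rule sum.swap)
  also have "\<dots> = (\<Sum>j\<in>UNIV. \<Sum>k\<in>UNIV. \<Sum>i\<in>UNIV. inner (B$j$k) (kcnj (A$i$j) * C$i$k))"
    by (rule sum.swap)
  also have "\<dots> = inner B (ctranspose A ** C)"
    by (simp add: inner_vec_vec matrix_matrix_mult_def inner_sum_right ctranspose_def)
  finally show ?thesis .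
qed

lemma inner_matrix_mult_right: "inner (A ** B) C = inner A (C ** ctranspose B)"
proof -
  have "inner (A ** B) C = inner (ctranspose B ** ctranspose A) (ctranspose C)"
    by (simp add: inner_ctranspose flip: ctranspose_mult)
  also have "\<dots> = inner (ctranspose A) (ctranspose (C ** ctranspose B))"
    by (simp add: inner_matrix_mult_left ctranspose_mult)
  finally show ?thesis by (simp only: inner_ctranspose)
qed

lemma inner_ctranspose_swap: "inner (ctranspose A) B = inner A (ctranspose B)"
  using inner_ctranspose[of A "ctranspose B"] by simp

section \<open>Real traces and the invariance of the inner product under
  \<open>\<sigma>\<close>\<close>

definition operator_trace :: "('b::euclidean_space \<Rightarrow> 'b) \<Rightarrow> real" where
  "operator_trace f = (\<Sum>b\<in>Basis. inner (f b) b)"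

text \<open>In matrix entries both sides are the same double sum over the basis, with the two
  summations exchanged.\<close>

lemma operator_trace_comp_commute:
  fixes f g :: "'b::euclidean_space \<Rightarrow> 'b"
  assumes "linear f" "linear g"
  shows "operator_trace (f \<circ> g) = operator_trace (g \<circ> f)"
proof -
  have *: "operator_trace (f \<circ> g) = (\<Sum>b\<in>Basis. \<Sum>c\<in>Basis. inner (g b) c * inner (f c) b)"
    if "linear f" for f g :: "'b \<Rightarrow> 'b"
    unfolding operator_trace_def comp_def
  proof (intro sum.cong refl)
    fix b :: 'b
    have "f (g b) = f (\<Sum>c\<in>Basis. inner (g b) c *\<^sub>R c)" by (simp add: euclidean_representation)
    also have "\<dots> = (\<Sum>c\<in>Basis. inner (g b) c *\<^sub>R f c)"
      by (simp add: linear_sum[OF that] linear_cmul[OF that])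
    finally show "inner (f (g b)) b = (\<Sum>c\<in>Basis. inner (g b) c * inner (f c) b)"
      by (simp add: inner_sum_left)
  qed
  show ?thesis unfolding *[OF assms(1)] *[OF assms(2)]
    by (subst sum.swap) (simp add: mult.commute)
qed

text \<open>The basis consists of the matrices with a single nonzero entry \<open>u\<close>, a
  scalar basis vector. Each contributes the real part of a diagonal entry of \<open>Z\<close>,
  because \<open>u * kcnj u\<close> is 1.\<close>

lemma operator_trace_matrix_mult_left:
  "operator_trace ((**) Z :: 'a::rch^'n^'n \<Rightarrow> 'a^'n^'n) = real (CARD('n) * DIM('a)) * inner Z (mat 1)"
proof -
  have cancel: "inner (x * u) u = inner x 1" if "u \<in> Basis" for x u :: 'a
    using that by (simp add: inner_mult_right_kcnj mult_kcnj)
  have B: "(Basis :: ('a^'n^'n) set) = (\<lambda>((i, j), u). axis i (axis j u)) ` ((UNIV \<times> UNIV) \<times> Basis)"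
    by (auto simp: Basis_vec_def image_iff Bex_def) blast
  have inj: "inj_on (\<lambda>((i, j), u). axis i (axis j u) :: 'a^'n^'n) ((UNIV \<times> UNIV) \<times> Basis)"
    by (auto simp: inj_on_def axis_eq_axis)
  have entry: "inner (Z ** axis i (axis j u)) (axis i (axis j u)) = inner (Z$i$i) 1"
    if "u \<in> Basis" for i j u
  proof -
    have "(Z ** axis i (axis j u)) $ i $ j = Z$i$i * u"
      by (simp add: matrix_matrix_mult_def axis_def if_distrib[where f="\<lambda>x. x $ _"]
          if_distrib[where f="(*) _"] sum.delta cong: if_cong)
    then show ?thesis using cancel[OF that] by (simp add: inner_axis)
  qed
  have "operator_trace ((**) Z :: 'a^'n^'n \<Rightarrow> 'a^'n^'n) = (\<Sum>((i, j), u)\<in>((UNIV::'n set) \<times> (UNIV::'n set)) \<times> (Basis::'a set). inner (Z$i$i) 1)"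
    unfolding operator_trace_def B sum.reindex[OF inj] comp_def
    by (intro sum.cong refl) (auto simp: entry)
  also have "\<dots> = real (CARD('n) * DIM('a)) * (\<Sum>i\<in>UNIV. inner (Z$i$i) 1)"
    by (simp add: sum.cartesian_product' sum_distrib_left mult.assoc del: UNIV_Times_UNIV)
  also have "(\<Sum>i\<in>UNIV. inner (Z$i$i) 1) = inner Z (mat 1)"
    by (simp add: inner_vec_vec mat_def if_distrib[where f="inner _"] cong: if_cong)
  finally show ?thesis .
qed

lemma involutive_star_automorphism_simps:
  assumes "involutive_star_automorphism \<sigma>"
  shows "\<sigma> (mat 1) = mat 1" "\<sigma> (A ** B) = \<sigma> A ** \<sigma> B" "\<sigma> (\<sigma> A) = A"
    "\<sigma> (ctranspose A) = ctranspose (\<sigma> A)" "\<sigma> (A + B) = \<sigma> A + \<sigma> B" "\<sigma> (A - B) = \<sigma> A - \<sigma> B"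
    "\<sigma> (- A) = - \<sigma> A" "\<sigma> (r *\<^sub>R A) = r *\<^sub>R \<sigma> A"
  using assms by (simp_all add: involutive_star_automorphism_def linear_add linear_diff linear_neg linear_cmul)

text \<open>Left multiplication by \<open>\<sigma> Z\<close> is conjugate to left multiplication by \<open>Z\<close>, and the real trace
  of \<open>Z\<close> is a multiple of the operator trace of the latter.\<close>

lemma inner_involutive_star_automorphism:
  fixes \<sigma> :: "'a::rch^'n^'n \<Rightarrow> 'a^'n^'n"
  assumes \<sigma>: "involutive_star_automorphism \<sigma>"
  shows "inner (\<sigma> A) (\<sigma> B) = inner A B"
proof -
  note s = involutive_star_automorphism_simps[OF \<sigma>]
  have lin: "linear \<sigma>" using \<sigma> by (simp add: involutive_star_automorphism_def)
  have *: "inner (\<sigma> Z) (mat 1) = inner Z (mat 1)" for Z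
  proof -
    have linZ: "linear ((**) Z :: 'a^'n^'n \<Rightarrow> 'a^'n^'n)"
      by (rule bounded_linear.linear[OF matrix_mult.bounded_linear_right])
    have "operator_trace ((**) (\<sigma> Z) :: 'a^'n^'n \<Rightarrow> 'a^'n^'n) = operator_trace (\<sigma> \<circ> ((**) Z \<circ> \<sigma>))"
      by (simp add: operator_trace_def s)
    also have "\<dots> = operator_trace (((**) Z \<circ> \<sigma>) \<circ> \<sigma>)"
      by (rule operator_trace_comp_commute[OF lin linear_compose[OF lin linZ]])
    also have "\<dots> = operator_trace ((**) Z :: 'a^'n^'n \<Rightarrow> 'a^'n^'n)"
      by (simp add: operator_trace_def s)
    finally show ?thesis
      unfolding operator_trace_matrix_mult_left by simp
  qed
  \<comment> \<open>Written as a real trace of a product, the inner product is respected by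
    \<open>\<sigma>\<close>, which preserves products and stars.\<close>
  have "inner A B = inner (ctranspose B ** A) (mat 1)" for A B :: "'a^'n^'n"
    by (simp add: inner_matrix_mult_left)
  with * show ?thesis by (metis s(2,4))
qed

section \<open>Inverses of matrices over a division algebra\<close>

lemma matrix_inv_works:
  assumes "invertible A"
  shows "A ** matrix_inv A = mat 1" "matrix_inv A ** A = mat 1"
  using someI_ex[OF assms[unfolded invertible_def]] by (auto simp: matrix_inv_def)

lemma matrix_mult_cancels:
  assumes "A ** B = mat 1"
  shows "C ** A ** B = (C :: 'a::semiring_1^'n^'m)"
  using assms by (metis matrix_mul_assoc matrix_mul_rid)

lemma matrix_inverse_unique:
  "A ** B = mat 1 \<Longrightarrow> C ** A = mat 1 \<Longrightarrow> B = (C :: 'a::semiring_1^'n^'m)"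
  by (metis matrix_mul_assoc matrix_mul_rid matrix_mul_lid)

lemma invertible_matrix_invI:
  assumes "A ** B = mat 1" "B ** A = mat 1"
  shows "invertible A" "matrix_inv A = (B :: 'a::semiring_1^'n^'m)"
proof -
  show *: "invertible A" using assms by (auto simp: invertible_def)
  show "matrix_inv A = B"
    using matrix_inverse_unique[OF assms(1) matrix_inv_works(2)[OF *]] by simp
qed

text \<open>Rank-nullity for left multiplication on the real vector space of matrices replaces
  determinants, which do not suit noncommutative scalars.\<close>

lemma matrix_left_inverse_imp_right_inverse:
  fixes A B :: "'a::rch^'n^'n"
  assumes "B ** A = mat 1"
  shows "A ** B = mat 1"
proof -
  have "linear ((**) A :: 'a^'n^'n \<Rightarrow> _)"
    by (rule bounded_linear.linear[OF matrix_mult.bounded_linear_right])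
  moreover have "inj ((**) A :: 'a^'n^'n \<Rightarrow> _)"
    by (rule inj_on_inverseI[where g = "(**) B"]) (simp add: matrix_mul_assoc assms)
  ultimately have "surj ((**) A :: 'a^'n^'n \<Rightarrow> _)" by (rule linear_injective_imp_surjective) simp
  then obtain C where C: "A ** C = mat 1" by (metis surjD)
  with matrix_inverse_unique[OF C assms] show ?thesis by simp
qed

lemma invertible_if_mult_injective:
  fixes A :: "'a::rch^'n^'n"
  assumes "\<And>Z :: 'a^'n^'n. A ** Z = 0 \<Longrightarrow> Z = 0"
  shows "invertible A"
proof -
  have lin: "linear ((**) A :: 'a^'n^'n \<Rightarrow> _)"
    by (rule bounded_linear.linear[OF matrix_mult.bounded_linear_right])
  then have "inj ((**) A :: 'a^'n^'n \<Rightarrow> _)" using assms by (simp add: linear_injective_0)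
  with lin have "surj ((**) A :: 'a^'n^'n \<Rightarrow> _)" by (rule linear_injective_imp_surjective) simp
  then obtain C where C: "A ** C = mat 1" by (metis surjD)
  with matrix_left_inverse_imp_right_inverse[OF C] show ?thesis by (auto simp: invertible_def)
qed

text \<open>If \<open>S ** Z = - Z\<close> with \<open>S\<close> skew, then
  \<open>inner (S ** Z) Z\<close> equals its own negative, which forces \<open>Z = 0\<close>. Hence
  every skew matrix lies in the domain of the Cayley transform at the identity.\<close>

lemma invertible_one_plus_skew:
  fixes S :: "'a::rch^'n^'n"
  assumes "ctranspose S = - S"
  shows "invertible (mat 1 + S)"
proof (rule invertible_if_mult_injective)
  fix Z :: "'a^'n^'n"
  assume "(mat 1 + S) ** Z = 0"
  then have Z: "S ** Z = - Z" by (simp add: matrix_ring_simps add_eq_0_iff)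
  have "inner (S ** Z) Z = inner Z (- (S ** Z))"
    unfolding inner_matrix_mult_left assms by (simp add: matrix_ring_simps)
  then have "inner Z Z = 0" unfolding Z by simp
  then show "Z = 0" by simp
qed

text \<open>A kernel element satisfies \<open>r *\<^sub>R Z = D ** Z\<close>, and the right side is
  strictly shorter than the left unless \<open>Z\<close> vanishes.\<close>

lemma invertible_near_scaleR_one:
  fixes D :: "'a::rch^'n^'n"
  assumes "norm D < r"
  shows "invertible (r *\<^sub>R mat 1 - D)"
proof (rule invertible_if_mult_injective)
  fix Z :: "'a^'n^'n"
  assume "(r *\<^sub>R mat 1 - D) ** Z = 0"
  then have "r *\<^sub>R Z = D ** Z" by (simp add: matrix_ring_simps)
  then have "r * norm Z \<le> norm D * norm Z"
    using norm_matrix_mult_le[of D Z] norm_scaleR[of r Z] assms norm_ge_zero[of D] by simp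
  with assms show "Z = 0" by (metis linorder_not_less mult_strict_right_mono zero_less_norm_iff)
qed

lemma matrix_inv_mult:
  fixes A B :: "'a::rch^'n^'n"
  assumes "invertible A" "invertible B"
  shows "matrix_inv (A ** B) = matrix_inv B ** matrix_inv A"
proof (rule invertible_matrix_invI(2))
  show "A ** B ** (matrix_inv B ** matrix_inv A) = mat 1" "matrix_inv B ** matrix_inv A ** (A ** B) = mat 1"
    using assms by (simp_all add: matrix_mul_assoc matrix_inv_works matrix_mult_cancels)
qed

text \<open>Factor \<open>y\<close> as \<open>x ** (mat 1 - E)\<close> with \<open>norm E\<close> at
  most 1/2; the bound follows by absorbing the term \<open>E ** matrix_inv y\<close>.\<close>

lemma norm_matrix_inv_le:
  fixes x y :: "'a::rch^'n^'n"
  assumes x: "invertible x" and xy: "norm (matrix_inv x) * norm (y - x) \<le> 1 / 2"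
  shows "invertible y" "norm (matrix_inv y) \<le> 2 * norm (matrix_inv x)"
proof -
  define E where "E = matrix_inv x ** (x - y)"
  have E: "norm E \<le> 1 / 2"
    using norm_matrix_mult_le[of "matrix_inv x" "x - y"] xy
    by (simp add: E_def norm_minus_commute)
  have "invertible (1 *\<^sub>R mat 1 - E)" by (rule invertible_near_scaleR_one) (use E in simp)
  then have "invertible (x ** (mat 1 - E))" using x by (simp add: invertible_mult)
  moreover have y: "x ** (mat 1 - E) = y"
    using x by (simp add: E_def matrix_ring_simps matrix_inv_works)
  ultimately show inv: "invertible y" by simp
  have "matrix_inv x = (mat 1 - E) ** matrix_inv y"
  proof -
    have "matrix_inv x = matrix_inv x ** (x ** (mat 1 - E)) ** matrix_inv y"
      unfolding y using inv by (simp add: matrix_inv_works matrix_mult_cancels)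
    also have "\<dots> = (mat 1 - E) ** matrix_inv y"
      using x by (simp add: matrix_mul_assoc matrix_inv_works)
    finally show ?thesis .
  qed
  then have "matrix_inv y = matrix_inv x + E ** matrix_inv y" by (simp add: matrix_ring_simps)
  then have "norm (matrix_inv y) \<le> norm (matrix_inv x) + norm (E ** matrix_inv y)"
    by (metis norm_triangle_ineq)
  also have "norm (E ** matrix_inv y) \<le> 1 / 2 * norm (matrix_inv y)"
    by (rule order_trans[OF norm_matrix_mult_le]) (use E in \<open>intro mult_right_mono, auto\<close>)
  finally show "norm (matrix_inv y) \<le> 2 * norm (matrix_inv x)" by simp
qed

text \<open>The resolvent identity, on which both the continuity and the derivative of inversion
  rest.\<close>

lemma matrix_inv_diff:
  fixes x y :: "'a::rch^'n^'n"
  assumes "invertible x" "invertible y"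
  shows "matrix_inv y - matrix_inv x = matrix_inv y ** (x - y) ** matrix_inv x"
  using assms by (simp add: matrix_ring_simps matrix_inv_works matrix_mult_cancels)

lemma eventually_invertible:
  fixes x :: "'a::rch^'n^'n"
  assumes "invertible x"
  shows "eventually (\<lambda>y. norm (matrix_inv x) * norm (y - x) \<le> 1 / 2) (nhds x)"
proof -
  have "((\<lambda>y. norm (matrix_inv x) * norm (y - x)) \<longlongrightarrow> norm (matrix_inv x) * norm (x - x)) (nhds x)"
    by (intro tendsto_intros filterlim_ident)
  then have "eventually (\<lambda>y. norm (matrix_inv x) * norm (y - x) < 1 / 2) (nhds x)"
    by (rule order_tendstoD) simp
  then show ?thesis by eventually_elim simp
qed

lemma open_invertible: "open {x :: 'a::rch^'n^'n. invertible x}"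
  unfolding open_subopen[of "{x. _ x}"]
proof (clarsimp)
  fix x :: "'a^'n^'n"
  assume "invertible x"
  from eventually_invertible[OF this] obtain T where "open T" "x \<in> T"
    "\<And>y. y \<in> T \<Longrightarrow> norm (matrix_inv x) * norm (y - x) \<le> 1 / 2"
    by (auto simp: eventually_nhds)
  then show "\<exists>T. open T \<and> x \<in> T \<and> T \<subseteq> Collect invertible"
    using norm_matrix_inv_le(1)[OF \<open>invertible x\<close>] by blast
qed

lemma isCont_matrix_inv:
  fixes x :: "'a::rch^'n^'n"
  assumes x: "invertible x"
  shows "isCont matrix_inv x"
proof -
  have ev: "eventually (\<lambda>y. norm (matrix_inv x) * norm (y - x) \<le> 1 / 2) (at x)"
    using eventually_invertible[OF x] by (rule eventually_nhds_conv_at[THEN iffD1, THEN conjunct1])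
  have "((\<lambda>y. matrix_inv y - matrix_inv x) \<longlongrightarrow> 0) (at x)"
  proof (rule Lim_null_comparison)
    show "eventually (\<lambda>y. norm (matrix_inv y - matrix_inv x) \<le>
        2 * norm (matrix_inv x) * norm (x - y) * norm (matrix_inv x)) (at x)"
      using ev
    proof eventually_elim
      case (elim y)
      note y = norm_matrix_inv_le[OF x elim]
      have "norm (matrix_inv y ** (x - y) ** matrix_inv x) \<le> norm (matrix_inv y) * norm (x - y) * norm (matrix_inv x)"
        by (meson norm_matrix_mult_le mult_right_mono norm_ge_zero order_trans)
      also have "\<dots> \<le> 2 * norm (matrix_inv x) * norm (x - y) * norm (matrix_inv x)"
        using y(2) by (intro mult_right_mono) auto
      finally show ?case by (simp only: matrix_inv_diff[OF x y(1)])
    qed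
    have "((\<lambda>y. 2 * norm (matrix_inv x) * norm (x - y) * norm (matrix_inv x)) \<longlongrightarrow>
        2 * norm (matrix_inv x) * norm (x - x) * norm (matrix_inv x)) (at x)"
      by (intro tendsto_intros)
    then show "((\<lambda>y. 2 * norm (matrix_inv x) * norm (x - y) * norm (matrix_inv x)) \<longlongrightarrow> 0) (at x)" by simp
  qed
  then show ?thesis by (simp add: isCont_def Lim_null[symmetric])
qed

text \<open>By the resolvent identity the remainder is
  \<open>(matrix_inv x - matrix_inv y) ** (y - x) ** matrix_inv x\<close>, whose first factor tends
  to zero by continuity.\<close>

lemma has_derivative_matrix_inv_at:
  fixes x :: "'a::rch^'n^'n"
  assumes x: "invertible x"
  shows "(matrix_inv has_derivative (\<lambda>h. - (matrix_inv x ** h ** matrix_inv x))) (at x)"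
  unfolding has_derivative_at_within
proof (intro conjI)
  show "bounded_linear (\<lambda>h. - (matrix_inv x ** h ** matrix_inv x))"
    by (intro bounded_linear_minus matrix_mult.bounded_linear_left[THEN bounded_linear_compose]
        matrix_mult.bounded_linear_right)
  have ev: "eventually (\<lambda>y. norm (matrix_inv x) * norm (y - x) \<le> 1 / 2) (at x)"
    using eventually_invertible[OF x] by (rule eventually_nhds_conv_at[THEN iffD1, THEN conjunct1])
  show "((\<lambda>y. (matrix_inv y - matrix_inv x - (- (matrix_inv x ** (y - x) ** matrix_inv x))) /\<^sub>R norm (y - x)) \<longlongrightarrow> 0) (at x)"
  proof (rule Lim_null_comparison)
    show "eventually (\<lambda>y. norm ((matrix_inv y - matrix_inv x - (- (matrix_inv x ** (y - x) ** matrix_inv x))) /\<^sub>R norm (y - x))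
        \<le> norm (matrix_inv x - matrix_inv y) * norm (matrix_inv x)) (at x)"
      using ev
    proof eventually_elim
      case (elim y)
      note y = norm_matrix_inv_le[OF x elim]
      have "matrix_inv y - matrix_inv x - (- (matrix_inv x ** (y - x) ** matrix_inv x)) =
          (matrix_inv x - matrix_inv y) ** (y - x) ** matrix_inv x"
        by (simp add: matrix_inv_diff[OF x y(1)]) (simp add: matrix_ring_simps)
      moreover have "norm ((matrix_inv x - matrix_inv y) ** (y - x) ** matrix_inv x) \<le>
          norm (matrix_inv x - matrix_inv y) * norm (y - x) * norm (matrix_inv x)"
        by (meson norm_matrix_mult_le mult_right_mono norm_ge_zero order_trans)
      ultimately show ?case
        by (cases "y = x") (simp_all add: divide_simps mult_ac)
    qed
    have "((\<lambda>y. norm (matrix_inv x - matrix_inv y) * norm (matrix_inv x)) \<longlongrightarrow>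
        norm (matrix_inv x - matrix_inv x) * norm (matrix_inv x)) (at x)"
      using isCont_matrix_inv[OF x] unfolding isCont_def by (intro tendsto_intros)
    then show "((\<lambda>y. norm (matrix_inv x - matrix_inv y) * norm (matrix_inv x)) \<longlongrightarrow> 0) (at x)" by simp
  qed
qed

lemma has_derivative_matrix_inv:
  fixes f :: "'b::real_normed_vector \<Rightarrow> 'a::rch^'n^'n"
  assumes "(f has_derivative f') (at x)" "invertible (f x)"
  shows "((\<lambda>x. matrix_inv (f x)) has_derivative (\<lambda>h. - (matrix_inv (f x) ** f' h ** matrix_inv (f x)))) (at x)"
  using has_derivative_compose[OF assms(1) has_derivative_matrix_inv_at[OF assms(2)]] .

lemma continuous_on_matrix_inv:
  fixes f :: "'b::topological_space \<Rightarrow> 'a::rch^'n^'n"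
  assumes "continuous_on U f" "\<And>x. x \<in> U \<Longrightarrow> invertible (f x)"
  shows "continuous_on U (\<lambda>x. matrix_inv (f x))"
  using assms isCont_matrix_inv
  by (intro continuous_on_compose2[of "{A. invertible A}" matrix_inv U f])
     (auto intro!: continuous_at_imp_continuous_on)

section \<open>Differentiability of all orders\<close>

text \<open>On an open set derivatives depend on local values only, so agreement on \<open>U\<close>
  passes to every order.\<close>

lemma Ck_on_cong:
  assumes "open U" "\<And>x. x \<in> U \<Longrightarrow> f x = g x"
  shows "Ck_on k U f \<longleftrightarrow> Ck_on k U g"
  using assms(2)
proof (induction k arbitrary: f g)
  case 0
  then show ?case by (simp cong: continuous_on_cong)
next
  case (Suc k)
  have d: "(f has_derivative f') (at x) \<longleftrightarrow> (g has_derivative f') (at x)" if "x \<in> U" for f' x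
    using has_derivative_transform_within_open[OF _ assms(1) that] Suc.prems by metis
  have diff: "f differentiable (at x) \<longleftrightarrow> g differentiable (at x)" if "x \<in> U" for x
    using d[OF that] by (simp add: differentiable_def)
  have "frechet_derivative f (at x) v = frechet_derivative g (at x) v" if "x \<in> U" for x v
    using d[OF that] by (simp add: frechet_derivative_def)
  then have "Ck_on k U (\<lambda>x. frechet_derivative f (at x) v) \<longleftrightarrow>
      Ck_on k U (\<lambda>x. frechet_derivative g (at x) v)" for v
    by (rule Suc.IH)
  with diff show ?case by (simp cong: ball_cong)
qed

text \<open>Allows any explicitly known derivative in place of the choice-based
  \<open>frechet_derivative\<close>.\<close>

lemma Ck_on_SucI:
  assumes "open U" "\<And>x. x \<in> U \<Longrightarrow> (f has_derivative f' x) (at x)" "\<And>v. Ck_on k U (\<lambda>x. f' x v)"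
  shows "Ck_on (Suc k) U f"
  using assms frechet_derivative_at[OF assms(2)]
  by (auto simp: differentiable_def cong: Ck_on_cong)

lemma Ck_on_Suc_has_derivative:
  assumes "Ck_on (Suc k) U f" "x \<in> U"
  shows "(f has_derivative frechet_derivative f (at x)) (at x)"
  using assms by (simp add: frechet_derivative_works)

lemma Ck_on_SucD: "Ck_on (Suc k) U f \<Longrightarrow> Ck_on k U f"
proof (induction k arbitrary: f)
  case 0
  then show ?case
    by (auto intro!: continuous_at_imp_continuous_on differentiable_imp_continuous_within)
next
  case (Suc k)
  then show ?case by (metis Ck_on.simps(2))
qed

lemma Ck_on_bounded_linear:
  assumes L: "bounded_linear L" and "open U" "Ck_on k U f"
  shows "Ck_on k U (\<lambda>x. L (f x))"
  using assms(3)
proof (induction k arbitrary: f)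
  case 0
  then show ?case by (simp add: bounded_linear.continuous_on[OF L])
next
  case (Suc k)
  show ?case
    using Suc by (intro Ck_on_SucI[OF \<open>open U\<close> bounded_linear.has_derivative[OF L]])
      (auto intro!: Ck_on_Suc_has_derivative)
qed

lemma Ck_on_const: "open U \<Longrightarrow> Ck_on k U (\<lambda>x. c)"
proof (induction k arbitrary: c)
  case (Suc k)
  then show ?case by (intro Ck_on_SucI[where f' = "\<lambda>_ _. 0"]) auto
qed simp

lemma Ck_on_ident: "open U \<Longrightarrow> Ck_on k U (\<lambda>x. x)"
  by (cases k) (auto intro!: Ck_on_SucI[where f' = "\<lambda>_ v. v"] Ck_on_const simp: continuous_on_id)

lemma Ck_on_add:
  assumes "open U" "Ck_on k U f" "Ck_on k U g"
  shows "Ck_on k U (\<lambda>x. f x + g x)"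
  using assms(2,3)
proof (induction k arbitrary: f g)
  case 0
  then show ?case by (simp add: continuous_on_add)
next
  case (Suc k)
  show ?case
    using Suc by (intro Ck_on_SucI[OF assms(1) has_derivative_add])
      (auto intro!: Ck_on_Suc_has_derivative)
qed

text \<open>The product rule leads to bilinear terms of one order less, in which the
  undifferentiated factors also count at the lower order.\<close>

lemma Ck_on_bounded_bilinear:
  assumes "bounded_bilinear B" "open U" "Ck_on k U f" "Ck_on k U g"
  shows "Ck_on k U (\<lambda>x. B (f x) (g x))"
  using assms(3,4)
proof (induction k arbitrary: f g)
  case 0
  then show ?case by (simp add: bounded_bilinear.continuous_on[OF assms(1)])
next
  case (Suc k)
  have "Ck_on k U f" "Ck_on k U g" using Suc.prems[THEN Ck_on_SucD] .
  with Suc show ?case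
    by (intro Ck_on_SucI[OF assms(2) bounded_bilinear.FDERIV[OF assms(1)]])
      (auto intro!: Ck_on_Suc_has_derivative Ck_on_add assms(2))
qed

text \<open>The derivative is a product of the inverse itself with the derivative of
  \<open>f\<close>, so smoothness bootstraps by induction.\<close>

lemma Ck_on_matrix_inv:
  fixes f :: "'b::real_normed_vector \<Rightarrow> 'a::rch^'n^'n"
  assumes "open U" "Ck_on k U f" "\<And>x. x \<in> U \<Longrightarrow> invertible (f x)"
  shows "Ck_on k U (\<lambda>x. matrix_inv (f x))"
  using assms(2)
proof (induction k)
  case 0
  then show ?case by (simp add: continuous_on_matrix_inv assms(3))
next
  case (Suc k)
  have inv: "Ck_on k U (\<lambda>x. matrix_inv (f x))"
    by (rule Suc.IH[OF Ck_on_SucD[OF Suc.prems]])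
  show ?case
  proof (rule Ck_on_SucI[OF assms(1) has_derivative_matrix_inv])
    show "(f has_derivative frechet_derivative f (at x)) (at x)" if "x \<in> U" for x
      using Suc.prems that by (rule Ck_on_Suc_has_derivative)
    show "Ck_on k U (\<lambda>x. - (matrix_inv (f x) ** frechet_derivative f (at x) v ** matrix_inv (f x)))" for v
      using Suc.prems inv assms(1)
      by (intro Ck_on_bounded_linear[OF bounded_linear_minus[OF bounded_linear_ident]]
          Ck_on_bounded_bilinear[OF bounded_bilinear_matrix_mult]) auto
  qed (rule assms(3))
qed

section \<open>The groups and the Cartan model\<close>

lemma O_groupD:
  assumes "A \<in> O_group"
  shows "A ** ctranspose A = mat 1" "ctranspose A ** A = mat 1"
  using assms matrix_left_inverse_imp_right_inverse by (auto simp: O_group_def)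

lemma O_group_mult: "A \<in> O_group \<Longrightarrow> B \<in> O_group \<Longrightarrow> A ** B \<in> O_group"
  by (simp add: O_group_def ctranspose_mult matrix_mul_assoc matrix_mult_cancels)

lemma O_group_ctranspose: "A \<in> O_group \<Longrightarrow> ctranspose A \<in> O_group"
  using O_groupD(2)[of A] by (simp add: O_group_def)

lemma invertible_O_group: "A \<in> O_group \<Longrightarrow> invertible A"
  and matrix_inv_O_group: "A \<in> O_group \<Longrightarrow> matrix_inv A = ctranspose A"
  using O_groupD[of A] invertible_matrix_invI by blast+

lemma norm_mult_O_group: "A \<in> O_group \<Longrightarrow> norm (Z ** A) = norm Z"
  by (simp add: norm_eq_sqrt_inner inner_matrix_mult_right matrix_mult_cancels[OF O_groupD(1)])

lemma G_group_subset: "G_group \<subseteq> O_group"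
  by (simp add: G_group_def connected_component_subset)

lemma mat_1_in_G_group: "mat 1 \<in> G_group"
  by (simp add: G_group_def O_group_def)

text \<open>The standard way below to reach the identity component: put the point on a connected
  subset of \<open>O_group\<close> that meets \<open>G_group\<close>.\<close>

lemma connected_subset_G_group:
  assumes "connected T" "T \<subseteq> O_group" "A \<in> T" "A \<in> G_group"
  shows "T \<subseteq> G_group"
  using connected_component_maximal[OF assms(3,1,2)] assms(4)
  by (simp add: G_group_def connected_component_eq)

lemma connected_G_group: "connected G_group"
  by (simp add: G_group_def)

text \<open>The left translate of \<open>G_group\<close> by \<open>A\<close> is connected and
  contains \<open>A\<close>, since \<open>G_group\<close> contains the identity.\<close>

lemma G_group_mult:
  assumes A: "A \<in> G_group" and B: "B \<in> G_group"
  shows "A ** B \<in> G_group"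
proof -
  have "(**) A ` G_group \<subseteq> G_group"
  proof (rule connected_subset_G_group)
    show "connected ((**) A ` G_group)"
      by (intro connected_continuous_image connected_G_group matrix_mult.continuous_on continuous_intros)
    show "(**) A ` G_group \<subseteq> O_group" using A G_group_subset O_group_mult by blast
    show "A \<in> (**) A ` G_group" using mat_1_in_G_group by (intro image_eqI[where x = "mat 1"]) auto
  qed (rule A)
  with B show ?thesis by blast
qed

lemma continuous_on_matrix_linear:
  "linear f \<Longrightarrow> continuous_on U (f :: 'a::rch^'n^'m \<Rightarrow> 'a^'p^'q)"
  by (rule linear_continuous_on[OF linear_conv_bounded_linear[THEN iffD1]])

lemma G_group_automorphism:
  fixes \<sigma> :: "'a::rch^'n^'n \<Rightarrow> 'a^'n^'n"
  assumes "involutive_star_automorphism \<sigma>" and B: "B \<in> G_group"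
  shows "\<sigma> B \<in> G_group"
proof -
  note s = involutive_star_automorphism_simps[OF assms(1)]
  have lin: "linear \<sigma>" using assms(1) by (simp add: involutive_star_automorphism_def)
  have "\<sigma> ` G_group \<subseteq> G_group"
  proof (rule connected_subset_G_group)
    show "connected (\<sigma> ` G_group)"
      by (intro connected_continuous_image connected_G_group continuous_on_matrix_linear lin)
    show "\<sigma> ` G_group \<subseteq> O_group"
    proof (rule image_subsetI)
      fix A :: "'a^'n^'n" assume "A \<in> G_group"
      then have "\<sigma> A ** ctranspose (\<sigma> A) = \<sigma> (mat 1)"
        using G_group_subset by (auto simp: O_group_def simp flip: s(2,4))
      then show "\<sigma> A \<in> O_group" by (simp add: O_group_def s(1))
    qed
    show "mat 1 \<in> \<sigma> ` G_group" using mat_1_in_G_group s(1) by (metis image_eqI)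
  qed (rule mat_1_in_G_group)
  with B show ?thesis by blast
qed

lemma cartan_model_iff:
  assumes "involutive_star_automorphism \<sigma>"
  shows "P \<in> cartan_model \<sigma> \<longleftrightarrow> (\<exists>B\<in>G_group. P = B ** ctranspose (\<sigma> B))"
proof -
  have "matrix_inv (\<sigma> B) = ctranspose (\<sigma> B)" if "B \<in> G_group" for B
    using G_group_automorphism[OF assms that] G_group_subset matrix_inv_O_group by blast
  then show ?thesis by (simp add: cartan_model_def) metis
qed

text \<open>Inside \<open>O_group\<close> the equation says that \<open>\<sigma>\<close> inverts
  \<open>Q\<close>. These conditions are easy to verify, and points that satisfy them and are close
  to the Cartan model turn out to lie in it.\<close>

definition symmetric_points :: "('a::rch^'n^'n \<Rightarrow> 'a^'n^'n) \<Rightarrow> ('a^'n^'n) set" where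
  "symmetric_points \<sigma> = {Q \<in> O_group. \<sigma> Q = ctranspose Q}"

lemma cartan_model_subset:
  assumes "involutive_star_automorphism \<sigma>"
  shows "cartan_model \<sigma> \<subseteq> symmetric_points \<sigma>"
proof
  fix P
  assume "P \<in> cartan_model \<sigma>"
  then obtain B where B: "B \<in> G_group" "P = B ** ctranspose (\<sigma> B)"
    using cartan_model_iff[OF assms] by blast
  moreover have "B \<in> O_group" "\<sigma> B \<in> O_group"
    using B(1) G_group_automorphism[OF assms] G_group_subset by blast+
  ultimately show "P \<in> symmetric_points \<sigma>"
    by (simp add: symmetric_points_def O_group_mult O_group_ctranspose ctranspose_mult
        involutive_star_automorphism_simps[OF assms])
qed

text \<open>If \<open>B\<close> represents \<open>P\<close>, then \<open>\<sigma> B\<close>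
  represents the conjugate transpose.\<close>

lemma cartan_model_ctranspose:
  assumes "involutive_star_automorphism \<sigma>" "P \<in> cartan_model \<sigma>"
  shows "ctranspose P \<in> cartan_model \<sigma>"
proof -
  obtain B where "B \<in> G_group" "P = B ** ctranspose (\<sigma> B)"
    using assms cartan_model_iff by blast
  then show ?thesis
    using G_group_automorphism[OF assms(1)] cartan_model_iff[OF assms(1)]
    by (intro cartan_model_iff[OF assms(1), THEN iffD2] bexI[of _ "\<sigma> B"])
      (simp_all add: ctranspose_mult involutive_star_automorphism_simps[OF assms(1)])
qed

section \<open>The Cayley transform at the identity\<close>

text \<open>This is \<open>cayley (mat 1)\<close>; the transforms centered at other points reduce to
  it by translation.\<close>

definition cay :: "'a::rch^'n^'n \<Rightarrow> 'a^'n^'n" where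
  "cay S = (mat 1 - S) ** matrix_inv (mat 1 + S)"

lemma cay_mult: "invertible (mat 1 + S) \<Longrightarrow> cay S ** (mat 1 + S) = mat 1 - S"
  by (simp add: cay_def matrix_mult_cancels matrix_inv_works)

lemma invertible_mult_right_cancel:
  "invertible B \<Longrightarrow> A ** B = C ** B \<Longrightarrow> A = (C :: 'a::rch^'n^'m)"
  by (metis matrix_inv_works(1) matrix_mult_cancels)

lemma cay_eqI: "invertible (mat 1 + S) \<Longrightarrow> C ** (mat 1 + S) = mat 1 - S \<Longrightarrow> cay S = C"
  by (rule invertible_mult_right_cancel[of "mat 1 + S"]) (simp_all add: cay_mult)

lemma matrix_inv_commute:
  assumes "invertible B" "A ** B = B ** (A :: 'a::rch^'n^'n)"
  shows "matrix_inv B ** A = A ** matrix_inv B"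
proof (rule invertible_mult_right_cancel[OF assms(1)])
  have "matrix_inv B ** A ** B = matrix_inv B ** B ** A"
    by (simp add: assms(2) flip: matrix_mul_assoc)
  then show "matrix_inv B ** A ** B = A ** matrix_inv B ** B"
    using assms(1) by (simp add: matrix_inv_works matrix_mult_cancels)
qed

lemma cay_mult': "invertible (mat 1 + S) \<Longrightarrow> (mat 1 + S) ** cay S = mat 1 - S"
  by (subst cay_def, subst matrix_inv_commute[symmetric])
    (simp_all add: matrix_mul_assoc matrix_inv_works, simp add: matrix_ring_simps)

lemma matrix_inv_ctranspose:
  assumes "invertible A"
  shows "invertible (ctranspose A)" "matrix_inv (ctranspose A) = ctranspose (matrix_inv A)"
proof -
  have "ctranspose A ** ctranspose (matrix_inv A) = mat 1" "ctranspose (matrix_inv A) ** ctranspose A = mat 1"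
    by (simp_all add: assms matrix_inv_works flip: ctranspose_mult)
  then show "invertible (ctranspose A)" "matrix_inv (ctranspose A) = ctranspose (matrix_inv A)"
    by (rule invertible_matrix_invI)+
qed

lemma ctranspose_cay:
  assumes "invertible (mat 1 + S)"
  shows "ctranspose (cay S) = cay (ctranspose S)"
proof (rule cay_eqI[symmetric])
  show "invertible (mat 1 + ctranspose S)"
    using matrix_inv_ctranspose(1)[OF assms] by (simp add: ctranspose_linear_simps)
  have "ctranspose (cay S) ** (mat 1 + ctranspose S) = ctranspose ((mat 1 + S) ** cay S)"
    by (simp add: ctranspose_mult ctranspose_linear_simps)
  then show "ctranspose (cay S) ** (mat 1 + ctranspose S) = mat 1 - ctranspose S"
    by (simp add: cay_mult'[OF assms] ctranspose_linear_simps)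
qed

text \<open>Intertwining passes to rational expressions. This serves both for compatibility with
  \<open>\<sigma>\<close> and for the equation of critical points.\<close>

lemma cay_intertwine:
  assumes "invertible (mat 1 + V)" "invertible (mat 1 + W)" "P ** V = W ** P"
  shows "P ** cay V = cay W ** P"
proof (rule invertible_mult_right_cancel[OF assms(1)])
  have "cay W ** P ** (mat 1 + V) = cay W ** (mat 1 + W) ** P"
    by (simp add: matrix_mult.add_left matrix_mult.add_right assms(3)[symmetric] flip: matrix_mul_assoc)
  also have "\<dots> = P ** (mat 1 - V)"
    by (simp add: cay_mult assms(2)) (simp add: matrix_ring_simps assms(3))
  finally show "P ** cay V ** (mat 1 + V) = cay W ** P ** (mat 1 + V)"
    by (simp add: cay_mult[OF assms(1)] flip: matrix_mul_assoc)
qed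

lemma cay_minus_inverse:
  assumes "invertible (mat 1 + S)" "invertible (mat 1 - S)"
  shows "cay S ** cay (- S) = mat 1"
proof -
  have "cay (- S) ** (mat 1 - S) = mat 1 + S" using cay_mult[of "- S"] assms(2) by simp
  then have "cay S ** cay (- S) ** (mat 1 - S) = mat 1 - S"
    by (simp add: cay_mult[OF assms(1)] flip: matrix_mul_assoc)
  then show ?thesis
    by (intro invertible_mult_right_cancel[OF assms(2), of _ "mat 1"]) simp
qed

lemma invertible_one_minus_skew: "ctranspose S = - S \<Longrightarrow> invertible (mat 1 - S)"
  using invertible_one_plus_skew[of "- S"] by (simp add: ctranspose_linear_simps)

text \<open>For skew \<open>S\<close> the conjugate transpose of \<open>cay S\<close> is
  \<open>cay (- S)\<close>, which is its inverse.\<close>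

lemma cay_skew_in_O_group:
  assumes "ctranspose S = - S"
  shows "cay S \<in> O_group"
  using assms by (simp add: O_group_def ctranspose_cay cay_minus_inverse
      invertible_one_plus_skew invertible_one_minus_skew)

lemma continuous_on_cay_line:
  assumes "ctranspose S = - S"
  shows "continuous_on UNIV (\<lambda>t::real. cay (t *\<^sub>R S))"
proof -
  have "invertible (mat 1 + t *\<^sub>R S)" for t
    using assms by (intro invertible_one_plus_skew) (simp add: ctranspose_linear_simps)
  then show ?thesis
    unfolding cay_def
    by (intro matrix_mult.continuous_on continuous_on_matrix_inv continuous_intros)
qed

lemma ctranspose_0 [simp]: "ctranspose 0 = (0 :: 'a::rch^'n^'m)"
  by (simp add: ctranspose_def vec_eq_iff)

lemma cay_0 [simp]: "cay 0 = mat 1"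
  by (rule cay_eqI) (use invertible_one_plus_skew[of 0] in simp_all)

text \<open>The images of the real multiples of \<open>S\<close> form a connected set in
  \<open>O_group\<close> through the identity.\<close>

lemma cay_skew_in_G_group:
  assumes "ctranspose S = - S"
  shows "cay S \<in> G_group"
proof -
  have "(\<lambda>t::real. cay (t *\<^sub>R S)) ` UNIV \<subseteq> G_group"
  proof (rule connected_subset_G_group[OF _ _ _ mat_1_in_G_group])
    show "connected ((\<lambda>t::real. cay (t *\<^sub>R S)) ` UNIV)"
      by (intro connected_continuous_image continuous_on_cay_line assms connected_UNIV)
    show "(\<lambda>t::real. cay (t *\<^sub>R S)) ` UNIV \<subseteq> O_group"
      using assms by (auto intro!: cay_skew_in_O_group simp: ctranspose_linear_simps)
    show "mat 1 \<in> (\<lambda>t::real. cay (t *\<^sub>R S)) ` UNIV"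
      by (rule image_eqI[where x = 0]) simp_all
  qed
  then have "cay (1 *\<^sub>R S) \<in> G_group" by blast
  then show ?thesis by simp
qed

text \<open>Everything follows from
  \<open>mat 1 + cay V = 2 *\<^sub>R matrix_inv (mat 1 + V)\<close>.\<close>

lemma cay_cay:
  assumes V: "invertible (mat 1 + V)"
  shows "invertible (mat 1 + cay V)" "cay (cay V) = V"
proof -
  let ?I = "matrix_inv (mat 1 + V)"
  have "(mat 1 + cay V) ** (mat 1 + V) = 2 *\<^sub>R mat 1"
    by (simp add: matrix_mult.add_left cay_mult[OF V] scaleR_2)
  from arg_cong[where f = "\<lambda>Z. Z ** ?I", OF this] have plus: "mat 1 + cay V = 2 *\<^sub>R ?I"
    by (simp add: matrix_mult_cancels[OF matrix_inv_works(1)[OF V]] matrix_mult.scaleR_left)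
  show inv: "invertible (mat 1 + cay V)"
    unfolding plus by (rule invertible_matrix_invI(1)[where B = "(1/2) *\<^sub>R (mat 1 + V)"])
      (simp_all add: matrix_mult.scaleR_left matrix_mult.scaleR_right matrix_inv_works[OF V])
  have "V ** (mat 1 + cay V) = 2 *\<^sub>R (V ** ?I)"
    unfolding plus by (simp add: matrix_mult.scaleR_right)
  also have "\<dots> = ((mat 1 + V) - (mat 1 - V)) ** ?I"
    by (simp add: matrix_mult.scaleR_left[symmetric] scaleR_2)
  also have "\<dots> = mat 1 - cay V"
    by (simp only: matrix_mult.diff_left matrix_inv_works[OF V] cay_def)
  finally show "cay (cay V) = V" using cay_eqI[OF inv] by blast
qed

lemma invertible_automorphism:
  assumes "involutive_star_automorphism \<sigma>" "invertible A"
  shows "invertible (\<sigma> A)" "matrix_inv (\<sigma> A) = \<sigma> (matrix_inv A)"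
proof -
  have "\<sigma> A ** \<sigma> (matrix_inv A) = mat 1" "\<sigma> (matrix_inv A) ** \<sigma> A = mat 1"
    by (simp_all add: assms(2) matrix_inv_works involutive_star_automorphism_simps(1)[OF assms(1)]
        flip: involutive_star_automorphism_simps(2)[OF assms(1)])
  then show "invertible (\<sigma> A)" "matrix_inv (\<sigma> A) = \<sigma> (matrix_inv A)"
    by (rule invertible_matrix_invI)+
qed

lemma automorphism_cay:
  assumes "involutive_star_automorphism \<sigma>" "invertible (mat 1 + S)"
  shows "\<sigma> (cay S) = cay (\<sigma> S)"
  using invertible_automorphism(2)[OF assms]
  by (simp add: cay_def involutive_star_automorphism_simps[OF assms(1)])

section \<open>Cayley transforms stay in the Cartan model\<close>

text \<open>The tangent space of the Cartan model at \<open>P\<close>, translated to the identity by right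
  multiplication with the inverse of \<open>P\<close>.\<close>

definition generators :: "('a::rch^'n^'n \<Rightarrow> 'a^'n^'n) \<Rightarrow> 'a^'n^'n \<Rightarrow> ('a^'n^'n) set" where
  "generators \<sigma> P = {S. ctranspose S = - S \<and> P ** \<sigma> S = - (S ** P)}"

lemma generators_scaleR:
  "involutive_star_automorphism \<sigma> \<Longrightarrow> S \<in> generators \<sigma> P \<Longrightarrow> r *\<^sub>R S \<in> generators \<sigma> P"
  by (simp add: generators_def ctranspose_linear_simps involutive_star_automorphism_simps
      matrix_mult.scaleR_left matrix_mult.scaleR_right)

text \<open>The generator condition says that \<open>P\<close> intertwines
  \<open>\<sigma> (- S)\<close> with \<open>S\<close>, and \<open>cay\<close> commutes with
  \<open>\<sigma>\<close>.\<close>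

lemma cay_generator_intertwine:
  assumes \<sigma>: "involutive_star_automorphism \<sigma>" and S: "S \<in> generators \<sigma> P"
  shows "P ** \<sigma> (cay (- S)) = cay S ** P"
proof -
  have S': "ctranspose S = - S" "P ** \<sigma> S = - (S ** P)" using S by (auto simp: generators_def)
  note inv = invertible_one_plus_skew[OF S'(1)] invertible_one_minus_skew[OF S'(1)]
  have "\<sigma> (cay (- S)) = cay (\<sigma> (- S))" using inv by (intro automorphism_cay[OF \<sigma>]) simp
  moreover have "P ** cay (\<sigma> (- S)) = cay S ** P"
    using invertible_automorphism(1)[OF \<sigma> inv(2)] inv(1) S'(2)
    by (intro cay_intertwine) (simp_all add: involutive_star_automorphism_simps[OF \<sigma>] matrix_ring_simps)
  ultimately show ?thesis by simp
qed

text \<open>Multiplying the intertwining relation for \<open>- S\<close> by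
  \<open>ctranspose P\<close> on both sides gives the required symmetry.\<close>

lemma symmetric_points_cay:
  assumes \<sigma>: "involutive_star_automorphism \<sigma>" and P: "P \<in> symmetric_points \<sigma>"
    and S: "S \<in> generators \<sigma> P"
  shows "cay S ** P \<in> symmetric_points \<sigma>"
proof -
  have S': "ctranspose S = - S" using S by (auto simp: generators_def)
  have P': "P \<in> O_group" "\<sigma> P = ctranspose P" using P by (auto simp: symmetric_points_def)
  note inv = invertible_one_plus_skew[OF S'] invertible_one_minus_skew[OF S']
  have "- S \<in> generators \<sigma> P" using generators_scaleR[OF \<sigma> S, of "-1"] by simp
  then have "P ** \<sigma> (cay S) = cay (- S) ** P"
    using cay_generator_intertwine[OF \<sigma>, of "- S" P] by simp
  then have "ctranspose P ** (P ** \<sigma> (cay S)) ** ctranspose P = ctranspose P ** (cay (- S) ** P) ** ctranspose P"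
    by simp
  then have "\<sigma> (cay S) ** ctranspose P = ctranspose P ** cay (- S)"
    by (simp add: matrix_mul_assoc O_groupD[OF P'(1)] matrix_mult_cancels[OF O_groupD(1)[OF P'(1)]])
  then show ?thesis
    using O_group_mult[OF cay_skew_in_O_group[OF S'] P'(1)]
    by (simp add: symmetric_points_def involutive_star_automorphism_simps[OF \<sigma>] P'(2)
        ctranspose_mult ctranspose_cay inv S')
qed

text \<open>With \<open>2 U = S (1 + U\<^sup>2)\<close>, the tangent half-angle formula, \<open>cay S\<close> is the square of \<open>cay U\<close>.\<close>

lemma generator_half_angle:
  assumes \<sigma>: "involutive_star_automorphism \<sigma>"
    and S: "S \<in> generators \<sigma> P" and norm: "norm S \<le> 1 / 2"
  obtains U where "U \<in> generators \<sigma> P" "cay U ** cay U = cay S"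
proof -
  note s = involutive_star_automorphism_simps[OF \<sigma>]
  have lin: "linear \<sigma>" using \<sigma> by (simp add: involutive_star_automorphism_def)
  have S': "ctranspose S = - S" "P ** \<sigma> S = - (S ** P)" using S by (auto simp: generators_def)
  \<comment> \<open>A closed set on which to iterate; commuting with \<open>S\<close> is what keeps
    \<open>S ** U ** U\<close> skew.\<close>
  define T where "T = {U \<in> generators \<sigma> P. U ** S = S ** U \<and> norm U \<le> 1 / 2}"
  \<comment> \<open>A fixed point of \<open>f\<close> solves the half-angle equation.\<close>
  define f where "f U = (1 / 2) *\<^sub>R (S + S ** U ** U)" for U
  have "closed T"
    unfolding T_def generators_def mem_Collect_eq
    by (intro closed_Collect_conj closed_Collect_eq closed_Collect_le continuous_intros
        matrix_mult.continuous_on continuous_on_matrix_linear[OF lin]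
        linear_continuous_on[OF bounded_linear_ctranspose])
  then have "complete T" by (simp add: complete_eq_closed)
  moreover have "T \<noteq> {}"
    by (auto simp: T_def generators_def ctranspose_linear_simps linear_0[OF lin]
        matrix_mult.zero_left matrix_mult.zero_right intro!: exI[of _ 0])
  moreover have "f ` T \<subseteq> T"
  proof (rule image_subsetI)
    fix U assume "U \<in> T"
    then have U: "ctranspose U = - U" "P ** \<sigma> U = - (U ** P)" "U ** S = S ** U" "norm U \<le> 1 / 2"
      by (auto simp: T_def generators_def)
    have UUS: "U ** (U ** S) = S ** (U ** U)" by (metis U(3) matrix_mul_assoc)
    have "ctranspose (S ** U ** U) = - (S ** U ** U)"
      by (simp add: ctranspose_mult S'(1) U(1) matrix_mult.minus_left matrix_mult.minus_right UUS
          flip: matrix_mul_assoc)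
    moreover have "P ** \<sigma> (S ** U ** U) = - (S ** U ** U ** P)"
    proof -
      have "P ** \<sigma> (S ** U ** U) = - (S ** (P ** \<sigma> U) ** \<sigma> U)"
        by (simp add: s S'(2) matrix_mult.minus_left matrix_mul_assoc)
      also have "\<dots> = S ** U ** (P ** \<sigma> U)"
        by (subst U(2)) (simp add: matrix_mult.minus_left matrix_mult.minus_right matrix_mul_assoc)
      also have "\<dots> = - (S ** U ** U ** P)"
        by (simp add: U(2) matrix_mult.minus_right matrix_mul_assoc)
      finally show ?thesis .
    qed
    ultimately have "f U \<in> generators \<sigma> P"
      by (simp add: generators_def f_def ctranspose_linear_simps s S' matrix_ring_simps
          scaleR_add_right scaleR_diff_right)
    moreover have "f U ** S = S ** f U"
      by (simp add: f_def matrix_mult.scaleR_left matrix_mult.scaleR_right matrix_mult.add_left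
          matrix_mult.add_right UUS flip: matrix_mul_assoc)
    \<comment> \<open>The image has norm at most half of 1/2 + 1/8, so the radius 1/2 is
      preserved.\<close>
    moreover have "norm (S ** U ** U) \<le> 1/2 * (1/2) * (1/2)"
      using norm U(4) by (intro order_trans[OF norm_matrix_mult_le] mult_mono) auto
    then have "norm (f U) \<le> 1 / 2"
      using norm norm_triangle_ineq[of S "S ** U ** U"] by (simp add: f_def)
    ultimately show "f U \<in> T" by (simp add: T_def)
  qed
  moreover have "dist (f U) (f V) \<le> (1 / 2) * dist U V" if "U \<in> T" "V \<in> T" for U V
  proof -
    \<comment> \<open>The difference of squares is telescoped without assuming that \<open>U\<close>
      and \<open>V\<close> commute. The product with \<open>S\<close> has norm at most
      \<open>norm (U - V)\<close>, so the factor 1/2 makes \<open>f\<close> a contraction.\<close>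
    have "f U - f V = (1 / 2) *\<^sub>R (S ** (U ** (U - V) + (U - V) ** V))"
      by (simp add: f_def matrix_ring_simps algebra_simps flip: scaleR_diff_right)
    moreover have "norm (U ** (U - V) + (U - V) ** V) \<le> 1 / 2 * norm (U - V) + norm (U - V) * (1 / 2)"
      using that by (intro norm_triangle_mono order_trans[OF norm_matrix_mult_le] mult_mono)
        (auto simp: T_def)
    then have "norm (S ** (U ** (U - V) + (U - V) ** V)) \<le> 1 * norm (U - V)"
      using norm by (intro order_trans[OF norm_matrix_mult_le] mult_mono) auto
    ultimately show ?thesis by (simp add: dist_norm)
  qed
  ultimately have "\<exists>!U. U \<in> T \<and> f U = U"
    by (intro Banach_fix[where c = "1 / 2"]) auto
  then obtain U where U: "U \<in> T" "f U = U" by blast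
  then have skew: "ctranspose U = - U" and comm: "U ** S = S ** U" by (auto simp: T_def generators_def)
  note inv = invertible_one_plus_skew[OF skew] invertible_one_plus_skew[OF S'(1)]
  have "2 *\<^sub>R f U = S + S ** U ** U" by (simp add: f_def)
  then have two: "U + U = S + S ** U ** U" by (simp add: U(2) scaleR_2)
  \<comment> \<open>Both squares carry the factor \<open>mat 1 + U ** U\<close>, so
    \<open>cay U ** cay U\<close> and \<open>cay S\<close> can be compared after multiplication by
    the square of \<open>mat 1 + U\<close>.\<close>
  have minus: "(mat 1 - U) ** (mat 1 - U) = (mat 1 - S) ** (mat 1 + U ** U)"
    using two by (simp add: matrix_ring_simps algebra_simps)
  have plus: "(mat 1 + U) ** (mat 1 + U) = (mat 1 + S) ** (mat 1 + U ** U)"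
    using two by (simp add: matrix_ring_simps algebra_simps)
  have "cay U ** cay U ** ((mat 1 + U) ** (mat 1 + U)) = cay U ** (mat 1 - U) ** (mat 1 + U)"
    by (simp add: matrix_mul_assoc) (simp add: cay_mult[OF inv(1)] flip: matrix_mul_assoc)
  also have "\<dots> = cay U ** (mat 1 + U) ** (mat 1 - U)"
    by (simp add: matrix_ring_simps)
  also have "\<dots> = cay S ** ((mat 1 + U) ** (mat 1 + U))"
    unfolding plus by (simp add: cay_mult[OF inv(1)] cay_mult[OF inv(2)] matrix_mul_assoc minus)
  finally have "cay U ** cay U = cay S"
    by (rule invertible_mult_right_cancel[rotated]) (simp add: invertible_mult inv)
  moreover have "U \<in> generators \<sigma> P" using U by (simp add: T_def)
  ultimately show thesis using that by blast
qed

text \<open>One of the two factors \<open>cay U\<close> of \<open>cay S\<close> moves across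
  \<open>P\<close> and becomes \<open>ctranspose (\<sigma> (cay U))\<close>. So if \<open>C\<close>
  represents \<open>P\<close>, then \<open>cay U ** C\<close> represents
  \<open>cay S ** P\<close>.\<close>

lemma cartan_model_cay_small:
  assumes \<sigma>: "involutive_star_automorphism \<sigma>" and P: "P \<in> cartan_model \<sigma>"
    and S: "S \<in> generators \<sigma> P" "norm S \<le> 1 / 2"
  shows "cay S ** P \<in> cartan_model \<sigma>"
proof -
  note s = involutive_star_automorphism_simps[OF \<sigma>]
  obtain U where U: "U \<in> generators \<sigma> P" "cay U ** cay U = cay S"
    by (rule generator_half_angle[OF \<sigma> S])
  have skew: "ctranspose U = - U" using U(1) by (simp add: generators_def)
  obtain C where C: "C \<in> G_group" "P = C ** ctranspose (\<sigma> C)"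
    using P cartan_model_iff[OF \<sigma>] by blast
  have "ctranspose (\<sigma> (cay U)) = \<sigma> (cay (- U))"
    by (simp add: ctranspose_cay invertible_one_plus_skew skew flip: s(4))
  then have "cay S ** P = cay U ** P ** ctranspose (\<sigma> (cay U))"
    using cay_generator_intertwine[OF \<sigma> U(1)] by (simp add: U(2)[symmetric] flip: matrix_mul_assoc)
  also have "\<dots> = (cay U ** C) ** ctranspose (\<sigma> (cay U ** C))"
    by (simp add: C(2) s ctranspose_mult matrix_mul_assoc)
  finally show ?thesis
    using G_group_mult[OF cay_skew_in_G_group[OF skew] C(1)] cartan_model_iff[OF \<sigma>] by blast
qed

text \<open>As for scalars: replacing v by 1/v changes the sign of (1 - v)/(1 + v).\<close>

lemma cay_ctranspose_O_group:
  assumes "V \<in> O_group" "invertible (mat 1 + V)"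
  shows "cay (ctranspose V) = - cay V"
proof (rule cay_eqI)
  have V: "ctranspose V ** (mat 1 + V) = mat 1 + ctranspose V" "(mat 1 + V) ** ctranspose V = mat 1 + ctranspose V"
    using O_groupD[OF assms(1)] by (simp_all add: matrix_ring_simps)
  show "invertible (mat 1 + ctranspose V)"
    using matrix_inv_ctranspose(1)[OF assms(2)] by (simp add: ctranspose_linear_simps)
  have "- cay V ** (mat 1 + ctranspose V) = - (mat 1 - V) ** ctranspose V"
    unfolding V(2)[symmetric] by (simp add: matrix_mul_assoc matrix_mult.minus_left cay_mult assms(2))
  also have "\<dots> = mat 1 - ctranspose V"
    using O_groupD[OF assms(1)] by (simp add: matrix_ring_simps)
  finally show "- cay V ** (mat 1 + ctranspose V) = mat 1 - ctranspose V" .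
qed

text \<open>A converse to \<open>symmetric_points_cay\<close>. With \<open>V\<close> the quotient,
  the symmetry of both points makes \<open>P\<close> intertwine \<open>\<sigma> V\<close> with
  \<open>ctranspose V\<close>, and \<open>cay\<close> turns the star of \<open>V\<close> into a
  sign.\<close>

lemma cay_quotient_generator:
  assumes \<sigma>: "involutive_star_automorphism \<sigma>"
    and P: "P \<in> symmetric_points \<sigma>" and Q: "Q \<in> symmetric_points \<sigma>"
    and inv: "invertible (mat 1 + Q ** ctranspose P)"
  shows "cay (Q ** ctranspose P) \<in> generators \<sigma> P"
proof -
  note s = involutive_star_automorphism_simps[OF \<sigma>]
  let ?V = "Q ** ctranspose P"
  have P': "P \<in> O_group" "\<sigma> P = ctranspose P" and Q': "Q \<in> O_group" "\<sigma> Q = ctranspose Q"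
    using P Q by (auto simp: symmetric_points_def)
  have V: "?V \<in> O_group" by (intro O_group_mult O_group_ctranspose P' Q')
  have "P ** \<sigma> (cay ?V) = cay (ctranspose ?V) ** P"
    unfolding automorphism_cay[OF \<sigma> inv]
  proof (rule cay_intertwine)
    show "invertible (mat 1 + \<sigma> ?V)"
      using invertible_automorphism(1)[OF \<sigma> inv] by (simp add: s)
    show "invertible (mat 1 + ctranspose ?V)"
      using matrix_inv_ctranspose(1)[OF inv] by (simp add: ctranspose_linear_simps)
    show "P ** \<sigma> ?V = ctranspose ?V ** P"
      by (simp add: s P' Q' ctranspose_mult matrix_mul_assoc)
  qed
  then show ?thesis
    by (simp add: generators_def ctranspose_cay[OF inv] cay_ctranspose_O_group[OF V inv]
        matrix_mult.minus_left)
qed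

text \<open>\<open>Q\<close> is \<open>cay S ** P\<close> for the generator
  \<open>S = cay (Q ** ctranspose P)\<close>, and closeness of \<open>P\<close> and \<open>Q\<close>
  makes \<open>S\<close> small.\<close>

lemma cartan_model_near:
  assumes \<sigma>: "involutive_star_automorphism \<sigma>" and P: "P \<in> cartan_model \<sigma>"
    and Q: "Q \<in> symmetric_points \<sigma>" and near: "norm (P - Q) \<le> 1 / 2"
  shows "Q \<in> cartan_model \<sigma>"
proof -
  let ?V = "Q ** ctranspose P" and ?D = "mat 1 - Q ** ctranspose P"
  have P': "P \<in> symmetric_points \<sigma>" "P \<in> O_group"
    using P cartan_model_subset[OF \<sigma>] by (auto simp: symmetric_points_def)
  have "?D = (P - Q) ** ctranspose P"
    by (simp add: matrix_mult.diff_left O_groupD[OF P'(2)])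
  then have D: "norm ?D \<le> 1 / 2"
    using near by (simp add: norm_mult_O_group O_group_ctranspose P'(2))
  have "invertible (2 *\<^sub>R mat 1 - ?D)"
    by (rule invertible_near_scaleR_one) (use D in simp)
  moreover have "2 *\<^sub>R mat 1 - ?D = mat 1 + ?V" by (simp add: scaleR_2)
  ultimately have inv: "invertible (mat 1 + ?V)" by (simp only:)
  \<comment> \<open>This is \<open>cay ?V ** (mat 1 + ?V) = mat 1 - ?V\<close> rewritten in terms of
    \<open>?D\<close>; it bounds the norm of \<open>cay ?V\<close> by 1/3.\<close>
  have "2 *\<^sub>R cay ?V = ?D + cay ?V ** ?D"
    using cay_mult[OF inv] by (simp add: matrix_ring_simps scaleR_2 algebra_simps)
  then have "2 * norm (cay ?V) \<le> norm ?D + norm (cay ?V ** ?D)"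
    by (metis norm_triangle_ineq norm_scaleR abs_numeral)
  also have "norm (cay ?V ** ?D) \<le> norm (cay ?V) * (1 / 2)"
    by (rule order_trans[OF norm_matrix_mult_le mult_left_mono[OF D]]) simp
  finally have "norm (cay ?V) \<le> 1 / 2" using D by simp
  from cartan_model_cay_small[OF \<sigma> P cay_quotient_generator[OF \<sigma> P'(1) Q inv] this]
  show ?thesis
    by (simp add: cay_cay[OF inv] matrix_mult_cancels[OF O_groupD(2)[OF P'(2)]])
qed

text \<open>By \<open>cartan_model_near\<close>, used in both directions, membership in the Cartan
  model is locally constant on \<open>symmetric_points\<close>. It therefore cannot change along the
  connected path from \<open>P\<close> to \<open>cay S ** P\<close>.\<close>

lemma cartan_model_cay:
  assumes \<sigma>: "involutive_star_automorphism \<sigma>" and P: "P \<in> cartan_model \<sigma>"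
    and S: "S \<in> generators \<sigma> P"
  shows "cay S ** P \<in> cartan_model \<sigma>"
proof -
  let ?c = "\<lambda>t::real. cay (t *\<^sub>R S) ** P"
  let ?T = "?c ` UNIV"
  have skew: "ctranspose S = - S" using S by (simp add: generators_def)
  have sym: "?T \<subseteq> symmetric_points \<sigma>"
    using P cartan_model_subset[OF \<sigma>] symmetric_points_cay[OF \<sigma> _ generators_scaleR[OF \<sigma> S]] by blast
  have "(?c 0 \<in> cartan_model \<sigma>) = (?c 1 \<in> cartan_model \<sigma>)"
  proof (rule connected_local_const[of ?T _ _ "\<lambda>Q. Q \<in> cartan_model \<sigma>"])
    show "connected ?T"
      by (intro connected_continuous_image matrix_mult.continuous_on continuous_on_cay_line skew
          continuous_intros connected_UNIV)
    show "\<forall>Q\<in>?T. eventually (\<lambda>R. (Q \<in> cartan_model \<sigma>) = (R \<in> cartan_model \<sigma>)) (at Q within ?T)"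
    proof
      fix Q assume Q: "Q \<in> ?T"
      have "eventually (\<lambda>R. dist R Q < 1 / 2) (at Q within ?T)"
        by (auto simp: eventually_at intro!: exI[of _ "1 / 2"])
      moreover have "eventually (\<lambda>R. R \<in> ?T) (at Q within ?T)"
        by (simp add: eventually_at_filter)
      ultimately show "eventually (\<lambda>R. (Q \<in> cartan_model \<sigma>) = (R \<in> cartan_model \<sigma>)) (at Q within ?T)"
      proof eventually_elim
        case (elim R)
        then have "norm (R - Q) \<le> 1 / 2" "norm (Q - R) \<le> 1 / 2"
          by (simp_all add: dist_norm norm_minus_commute)
        with elim(2) Q sym cartan_model_near[OF \<sigma>] show ?case by blast
      qed
    qed
  qed (rule rangeI)+
  with P show ?thesis by simp
qed

lemma Ck_on_diff:
  assumes "open U" "Ck_on k U f" "Ck_on k U g"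
  shows "Ck_on k U (\<lambda>x. f x - g x)"
  using Ck_on_add[OF assms(1,2) Ck_on_bounded_linear[OF bounded_linear_minus[OF bounded_linear_ident] assms(1,3)]]
  by simp

lemma smooth_map_onI:
  "open U \<Longrightarrow> S \<subseteq> U \<Longrightarrow> (\<And>k. Ck_on k U f) \<Longrightarrow> smooth_map_on S f"
  unfolding smooth_map_on_def by blast

lemma smooth_map_on_cong:
  "smooth_map_on S f \<Longrightarrow> (\<And>x. x \<in> S \<Longrightarrow> f x = g x) \<Longrightarrow> smooth_map_on S g"
  unfolding smooth_map_on_def by (metis IntD1)

section \<open>Tangent spaces and critical points\<close>

text \<open>Near 0 the curve agrees with a smooth local extension and inherits its
  derivative.\<close>

lemma smooth_curve_at_has_vector_derivative:
  assumes "smooth_curve_at M p \<gamma>"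
  obtains v where "(\<gamma> has_vector_derivative v) (at 0)"
proof -
  obtain e where e: "e > 0" "smooth_map_on {-e<..<e} \<gamma>"
    using assms by (auto simp: smooth_curve_at_def)
  then have "0 \<in> {-e<..<e}" by simp
  then obtain U g where U: "open U" "0 \<in> U" "\<forall>k. Ck_on k U g" "\<forall>y\<in>{-e<..<e} \<inter> U. g y = \<gamma> y"
    using e(2) unfolding smooth_map_on_def by blast
  then have "g differentiable (at 0)" using Ck_on.simps(2)[of 0 U g] by blast
  then have "(g has_vector_derivative vector_derivative g (at 0)) (at 0)"
    by (simp add: vector_derivative_works)
  then have "(\<gamma> has_vector_derivative vector_derivative g (at 0)) (at 0)"
    by (rule has_vector_derivative_transform_within_open[where S = "{-e<..<e} \<inter> U"])
      (use U e in auto)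
  then show thesis by (rule that)
qed

text \<open>By the chain rule only velocities matter, and every admissible curve has one.\<close>

lemma critical_points_linear_iff:
  assumes f: "bounded_linear f" and "p \<in> M"
  shows "p \<in> critical_points f M \<longleftrightarrow> (\<forall>v\<in>tangent_space M p. f v = 0)"
proof -
  have d: "((\<lambda>t. f (\<gamma> t)) has_real_derivative f v) (at 0)"
    if "(\<gamma> has_vector_derivative v) (at 0)" for \<gamma> v
    using bounded_linear.has_vector_derivative[OF f that]
    by (simp add: has_real_derivative_iff_has_vector_derivative)
  show ?thesis
  proof
    assume crit: "p \<in> critical_points f M"
    show "\<forall>v\<in>tangent_space M p. f v = 0"
    proof
      fix v assume "v \<in> tangent_space M p"
      then obtain \<gamma> where "smooth_curve_at M p \<gamma>" "(\<gamma> has_vector_derivative v) (at 0)"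
        by (auto simp: tangent_space_def)
      with crit d show "f v = 0" unfolding critical_points_def by (blast intro: DERIV_unique)
    qed
  next
    assume zero: "\<forall>v\<in>tangent_space M p. f v = 0"
    have "((\<lambda>t. f (\<gamma> t)) has_real_derivative 0) (at 0)" if \<gamma>: "smooth_curve_at M p \<gamma>" for \<gamma>
    proof -
      obtain v where v: "(\<gamma> has_vector_derivative v) (at 0)"
        by (rule smooth_curve_at_has_vector_derivative[OF \<gamma>])
      with \<gamma> zero have "f v = 0" by (auto simp: tangent_space_def)
      with d[OF v] show ?thesis by simp
    qed
    with \<open>p \<in> M\<close> show "p \<in> critical_points f M" by (simp add: critical_points_def)
  qed
qed

section \<open>Smoothness of the generalized Cayley transform\<close>

lemma open_Omega: "open (Omega A)"
  unfolding Omega_def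
  using continuous_open_vimage[OF open_invertible, of "\<lambda>Y. A + Y"]
  by (simp add: vimage_def continuous_on_add)

lemma Ck_on_cayley: "Ck_on k (Omega A) (cayley A)"
proof -
  have "Ck_on k (Omega A) (\<lambda>Y. (mat 1 - ctranspose A ** Y) ** matrix_inv (A + Y))"
    by (intro Ck_on_bounded_bilinear[OF bounded_bilinear_matrix_mult] open_Omega Ck_on_matrix_inv
        Ck_on_diff Ck_on_add Ck_on_const Ck_on_ident) (simp add: Omega_def)
  then show ?thesis by (simp add: cayley_def[abs_def])
qed

text \<open>Explicit curves for all tangent directions of the Cartan model; the velocity comes from
  \<open>cay (t *\<^sub>R S)\<close> being \<open>mat 1 - (2 * t) *\<^sub>R S\<close> to first
  order.\<close>

lemma cay_curve:
  assumes \<sigma>: "involutive_star_automorphism \<sigma>" and P: "P \<in> cartan_model \<sigma>"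
    and S: "S \<in> generators \<sigma> P"
  shows "smooth_curve_at (cartan_model \<sigma>) P (\<lambda>t. cay (t *\<^sub>R S) ** P)"
    and "((\<lambda>t. cay (t *\<^sub>R S) ** P) has_vector_derivative - (2 *\<^sub>R S) ** P) (at 0)"
proof -
  have skew: "ctranspose S = - S" using S by (simp add: generators_def)
  have inv: "invertible (mat 1 + t *\<^sub>R S)" for t
    using skew by (intro invertible_one_plus_skew) (simp add: ctranspose_linear_simps)
  have "Ck_on k UNIV (\<lambda>t. (mat 1 - t *\<^sub>R S) ** matrix_inv (mat 1 + t *\<^sub>R S) ** P)" for k
    using inv
    by (intro Ck_on_bounded_bilinear[OF bounded_bilinear_matrix_mult] Ck_on_matrix_inv open_UNIV
        Ck_on_diff Ck_on_add Ck_on_const Ck_on_bounded_linear[OF bounded_linear_scaleR_left] Ck_on_ident)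
  then have "smooth_map_on {-1<..<1} (\<lambda>t. cay (t *\<^sub>R S) ** P)"
    by (intro smooth_map_onI[of UNIV]) (auto simp: cay_def)
  then show "smooth_curve_at (cartan_model \<sigma>) P (\<lambda>t. cay (t *\<^sub>R S) ** P)"
    using cartan_model_cay[OF \<sigma> P generators_scaleR[OF \<sigma> S]]
    by (auto simp: smooth_curve_at_def intro!: exI[of _ 1])
  have I: "matrix_inv (mat 1) = (mat 1 :: 'a^'n^'n)"
    by (rule invertible_matrix_invI) simp_all
  have plus: "((\<lambda>t. mat 1 + t *\<^sub>R S) has_derivative (\<lambda>h. h *\<^sub>R S)) (at 0)"
    and minus: "((\<lambda>t. mat 1 - t *\<^sub>R S) has_derivative (\<lambda>h. - (h *\<^sub>R S))) (at 0)"
    by (auto intro!: derivative_eq_intros)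
  have "((\<lambda>t. cay (t *\<^sub>R S) ** P) has_derivative
      (\<lambda>h. (mat 1 ** - (mat 1 ** (h *\<^sub>R S) ** mat 1) + - (h *\<^sub>R S) ** mat 1) ** P)) (at 0)"
    unfolding cay_def
    by (rule bounded_linear.has_derivative[OF matrix_mult.bounded_linear_left])
      (use matrix_mult.FDERIV[OF minus has_derivative_matrix_inv[OF plus inv]] in \<open>simp add: I\<close>)
  then show "((\<lambda>t. cay (t *\<^sub>R S) ** P) has_vector_derivative - (2 *\<^sub>R S) ** P) (at 0)"
    unfolding has_vector_derivative_def
    by (rule has_derivative_eq_rhs) (simp add: fun_eq_iff matrix_ring_simps scaleR_2 scaleR_diff_right algebra_simps)
qed

text \<open>One inclusion differentiates the two equations of \<open>symmetric_points\<close> along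
  a curve; the other uses the curves of \<open>cay_curve\<close>.\<close>

lemma tangent_space_cartan_model:
  assumes \<sigma>: "involutive_star_automorphism \<sigma>" and P: "P \<in> cartan_model \<sigma>"
  shows "tangent_space (cartan_model \<sigma>) P = (\<lambda>S. S ** P) ` generators \<sigma> P"
proof (intro equalityI subsetI)
  note s = involutive_star_automorphism_simps[OF \<sigma>]
  have P': "P \<in> O_group" "\<sigma> P = ctranspose P"
    using P cartan_model_subset[OF \<sigma>] by (auto simp: symmetric_points_def)
  fix Y assume "Y \<in> tangent_space (cartan_model \<sigma>) P"
  then obtain \<gamma> where \<gamma>: "smooth_curve_at (cartan_model \<sigma>) P \<gamma>" "(\<gamma> has_vector_derivative Y) (at 0)"
    by (auto simp: tangent_space_def)
  then obtain e where e: "\<gamma> 0 = P" "e > 0" "\<gamma> ` {-e<..<e} \<subseteq> cartan_model \<sigma>"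
    by (auto simp: smooth_curve_at_def)
  have in_M: "\<gamma> t \<in> O_group" "\<sigma> (\<gamma> t) = ctranspose (\<gamma> t)" if "t \<in> {-e<..<e}" for t
  proof -
    have "\<gamma> t \<in> symmetric_points \<sigma>" using that e(3) cartan_model_subset[OF \<sigma>] by blast
    then show "\<gamma> t \<in> O_group" "\<sigma> (\<gamma> t) = ctranspose (\<gamma> t)"
      by (auto simp: symmetric_points_def)
  qed
  have const: "v = 0" if "((\<lambda>t. f t) has_vector_derivative v) (at 0)" "\<And>t. t \<in> {-e<..<e} \<Longrightarrow> f t = c"
    for f :: "real \<Rightarrow> 'a^'n^'n" and v c
  proof -
    have "((\<lambda>t. c) has_vector_derivative v) (at 0)"
      by (rule has_vector_derivative_transform_within_open[OF that(1), of "{-e<..<e}"])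
        (use that(2) e(2) in auto)
    then show ?thesis by (rule vector_derivative_unique_at) (rule has_vector_derivative_const)
  qed
  note d_star = bounded_linear.has_vector_derivative[OF bounded_linear_ctranspose \<gamma>(2)]
  have lin: "bounded_linear \<sigma>"
    using \<sigma> by (simp add: involutive_star_automorphism_def linear_conv_bounded_linear)
  have "P ** ctranspose Y + Y ** ctranspose P = 0"
    using const[OF matrix_mult.has_vector_derivative[OF \<gamma>(2) d_star] O_groupD(1)[OF in_M(1)]]
    by (simp add: e(1))
  then have 1: "P ** ctranspose Y = - (Y ** ctranspose P)" by (simp add: eq_neg_iff_add_eq_0)
  have "\<sigma> Y - ctranspose Y = 0"
    by (rule const[OF has_vector_derivative_diff[OF bounded_linear.has_vector_derivative[OF lin \<gamma>(2)] d_star]])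
      (simp add: in_M(2))
  then have 2: "\<sigma> Y = ctranspose Y" by simp
  have "P ** \<sigma> (Y ** ctranspose P) = - (Y ** ctranspose P ** P)"
    by (simp add: s P' 2 1 matrix_mul_assoc matrix_mult.minus_left)
  then have "Y ** ctranspose P \<in> generators \<sigma> P"
    by (simp add: generators_def ctranspose_mult 1)
  then show "Y \<in> (\<lambda>S. S ** P) ` generators \<sigma> P"
    by (rule image_eqI[rotated]) (simp add: matrix_mult_cancels[OF O_groupD(2)[OF P'(1)]])
next
  fix Y assume "Y \<in> (\<lambda>S. S ** P) ` generators \<sigma> P"
  then obtain S where S: "S \<in> generators \<sigma> P" "Y = S ** P" by blast
  \<comment> \<open>The multiple -1/2 undoes the velocity factor -2 of the Cayley curve.\<close>
  have "- (2 *\<^sub>R (- (1 / 2) *\<^sub>R S)) ** P = Y" by (simp add: S(2))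
  with cay_curve[OF \<sigma> P generators_scaleR[OF \<sigma> S(1), of "- (1 / 2)"]]
  show "Y \<in> tangent_space (cartan_model \<sigma>) P" unfolding tangent_space_def by auto
qed

lemma generators_ctranspose:
  assumes \<sigma>: "involutive_star_automorphism \<sigma>" and P: "P \<in> symmetric_points \<sigma>"
    and S: "S \<in> generators \<sigma> P"
  shows "ctranspose P ** S ** P \<in> generators \<sigma> (ctranspose P)"
proof -
  note s = involutive_star_automorphism_simps[OF \<sigma>]
  have P': "P \<in> O_group" "\<sigma> P = ctranspose P" using P by (auto simp: symmetric_points_def)
  have S': "ctranspose S = - S" "P ** \<sigma> S = - (S ** P)" using S by (auto simp: generators_def)
  show ?thesis
    by (simp add: generators_def ctranspose_mult s P' S' matrix_mult.minus_left matrix_mult.minus_right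
        matrix_mul_assoc O_groupD[OF P'(1)] matrix_mult_cancels[OF O_groupD(1)[OF P'(1)]])
qed

text \<open>Conjugation by \<open>A\<close> matches the generators at \<open>A\<close> and at
  \<open>ctranspose A\<close> and turns right translation into left translation, the form in which
  \<open>S_space\<close> is parametrized.\<close>

lemma tangent_space_cartan_model_ctranspose:
  assumes \<sigma>: "involutive_star_automorphism \<sigma>" and A: "A \<in> cartan_model \<sigma>"
  shows "tangent_space (cartan_model \<sigma>) (ctranspose A) = (\<lambda>S. ctranspose A ** S) ` generators \<sigma> A"
proof -
  have A': "A \<in> symmetric_points \<sigma>" "ctranspose A \<in> symmetric_points \<sigma>" "A \<in> O_group"
    using A cartan_model_ctranspose[OF \<sigma> A] cartan_model_subset[OF \<sigma>]
    by (auto simp: symmetric_points_def)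
  note O = O_groupD[OF A'(3)]
  have gen: "generators \<sigma> (ctranspose A) = (\<lambda>S. ctranspose A ** S ** A) ` generators \<sigma> A"
  proof (intro equalityI subsetI)
    fix S assume S: "S \<in> generators \<sigma> (ctranspose A)"
    from generators_ctranspose[OF \<sigma> A'(2) S] have "A ** S ** ctranspose A \<in> generators \<sigma> A" by simp
    then show "S \<in> (\<lambda>S. ctranspose A ** S ** A) ` generators \<sigma> A"
      by (rule image_eqI[rotated]) (simp add: matrix_mul_assoc O matrix_mult_cancels[OF O(2)])
  qed (use generators_ctranspose[OF \<sigma> A'(1)] in blast)
  show ?thesis
    unfolding tangent_space_cartan_model[OF \<sigma> cartan_model_ctranspose[OF \<sigma> A]] gen image_image
    by (simp add: matrix_mult_cancels[OF O(1)])
qed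

text \<open>The skew matrix \<open>X_hat \<sigma> X ** ctranspose P - P ** ctranspose (X_hat \<sigma> X)\<close> is four times the
  projection onto the generators of the gradient of the height function.\<close>

lemma critical_points_height_iff:
  assumes \<sigma>: "involutive_star_automorphism \<sigma>" and P: "P \<in> cartan_model \<sigma>"
  shows "P \<in> critical_points (height X) (cartan_model \<sigma>) \<longleftrightarrow>
    X_hat \<sigma> X ** ctranspose P = P ** ctranspose (X_hat \<sigma> X)"
proof -
  note s = involutive_star_automorphism_simps[OF \<sigma>]
  have P': "P \<in> O_group" "\<sigma> P = ctranspose P"
    using P cartan_model_subset[OF \<sigma>] by (auto simp: symmetric_points_def)
  note O = O_groupD[OF P'(1)]
  let ?W = "X_hat \<sigma> X ** ctranspose P"
  have W: "ctranspose ?W = P ** ctranspose (X_hat \<sigma> X)" by (simp add: ctranspose_mult)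
  have hat: "\<sigma> (X_hat \<sigma> X) = ctranspose (X_hat \<sigma> X)"
    by (simp add: X_hat_def s ctranspose_linear_simps)
  \<comment> \<open>Against a generator the two summands of \<open>X_hat\<close> contribute equally,
    and subtracting the conjugate transpose doubles the value again, hence the factor 4.\<close>
  have inner: "inner S (?W - ctranspose ?W) = 4 * height X (S ** P)" if "S \<in> generators \<sigma> P" for S
  proof -
    have S: "ctranspose S = - S" "P ** \<sigma> S = - (S ** P)" using that by (auto simp: generators_def)
    have "inner S (\<sigma> X ** ctranspose P) = inner (S ** P) (\<sigma> X)"
      by (simp add: inner_matrix_mult_right)
    also have "\<dots> = - inner (P ** \<sigma> S) (\<sigma> X)" by (simp add: S(2))
    also have "\<dots> = - inner (\<sigma> S) (\<sigma> (P ** X))" by (simp add: inner_matrix_mult_left s P'(2))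
    also have "\<dots> = - inner S (P ** X)" by (simp add: inner_involutive_star_automorphism[OF \<sigma>])
    also have "\<dots> = inner (ctranspose S) (P ** X)" by (simp add: S(1))
    also have "\<dots> = inner S (ctranspose X ** ctranspose P)"
      by (simp add: inner_ctranspose_swap ctranspose_mult)
    finally have "inner S ?W = 2 * inner S (ctranspose X ** ctranspose P)"
      by (simp add: X_hat_def matrix_mult.add_left inner_add_right)
    also have "inner S (ctranspose X ** ctranspose P) = height X (S ** P)"
      by (simp add: height_eq_inner inner_matrix_mult_right)
    finally have "inner S ?W = 2 * height X (S ** P)" .
    moreover have "inner S (ctranspose ?W) = - inner S ?W"
      by (simp add: inner_ctranspose_swap[symmetric] S(1))
    ultimately show ?thesis by (simp add: inner_diff_right)
  qed
  \<comment> \<open>The skew matrix is itself a generator, so vanishing of the height on all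
    generators makes it orthogonal to itself.\<close>
  have test: "?W - ctranspose ?W \<in> generators \<sigma> P"
    unfolding W by (simp add: generators_def s hat P' ctranspose_mult ctranspose_linear_simps matrix_ring_simps
        O matrix_mult_cancels[OF O(1)] matrix_mult_cancels[OF O(2)])
  have "(\<forall>S\<in>generators \<sigma> P. height X (S ** P) = 0) \<longleftrightarrow> ?W = ctranspose ?W"
  proof
    assume "\<forall>S\<in>generators \<sigma> P. height X (S ** P) = 0"
    with inner[OF test] test have "inner (?W - ctranspose ?W) (?W - ctranspose ?W) = 0" by simp
    then show "?W = ctranspose ?W" by (simp only: inner_eq_zero_iff right_minus_eq)
  next
    assume W': "?W = ctranspose ?W"
    have "?W - ctranspose ?W = 0" using W' by (simp only: right_minus_eq)
    then show "\<forall>S\<in>generators \<sigma> P. height X (S ** P) = 0"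
      using inner by simp
  qed
  moreover have "bounded_linear (height X)"
    by (simp add: height_eq_inner[abs_def] bounded_linear_inner_left)
  ultimately show ?thesis
    unfolding W
    by (simp add: critical_points_linear_iff[OF _ P] tangent_space_cartan_model[OF \<sigma> P])
qed

section \<open>Matching \<open>S_space\<close> with the critical points through the Cayley
  transform\<close>

theorem theorem4p2:
  fixes \<sigma> :: "'a::rch^'n^'n \<Rightarrow> 'a^'n^'n" and X A :: "'a^'n^'n"
  assumes "involutive_star_automorphism \<sigma>"
    and "X \<noteq> 0"
    and "A \<in> critical_points (height X) (cartan_model \<sigma>)"
  shows "subspace (S_space \<sigma> X A) \<and>
    S_space \<sigma> X A \<subseteq> Omega (ctranspose A) \<and>
    diffeomorphism (S_space \<sigma> X A)
      (critical_points (height X) (cartan_model \<sigma>) \<inter> (Omega A \<inter> cartan_model \<sigma>))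
      (cayley (ctranspose A))"
proof -
  note \<sigma> = assms(1)
  note s = involutive_star_automorphism_simps[OF \<sigma>]
  have A: "A \<in> cartan_model \<sigma>" using assms(3) by (simp add: critical_points_def)
  then have A': "A \<in> symmetric_points \<sigma>" "A \<in> O_group"
    using cartan_model_subset[OF \<sigma>] by (auto simp: symmetric_points_def)
  note O = O_groupD[OF A'(2)] and cancels = O_groupD[OF A'(2), THEN matrix_mult_cancels]
  define H where "H = X_hat \<sigma> X ** ctranspose A"
  \<comment> \<open>Criticality of \<open>A\<close> makes \<open>H\<close> Hermitian.\<close>
  have H: "H = A ** ctranspose (X_hat \<sigma> X)"
    using critical_points_height_iff[OF \<sigma> A] assms(3) by (simp add: H_def)
  \<comment> \<open>\<open>V\<close> is \<open>S_space\<close> translated to the identity.\<close>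
  define V where "V = {S \<in> generators \<sigma> A. H ** S + S ** H = 0}"
  let ?T = "critical_points (height X) (cartan_model \<sigma>) \<inter> (Omega A \<inter> cartan_model \<sigma>)"
  let ?f = "cayley (ctranspose A)" and ?g = "cayley A"
  have S_space: "S_space \<sigma> X A = (\<lambda>S. ctranspose A ** S) ` V"
  proof -
    have "ctranspose A ** X_hat \<sigma> X ** (ctranspose A ** S) + ctranspose A ** S ** X_hat \<sigma> X ** ctranspose A = 0
      \<longleftrightarrow> H ** S + S ** H = 0" for S
    proof -
      have "ctranspose A ** X_hat \<sigma> X ** (ctranspose A ** S) + ctranspose A ** S ** X_hat \<sigma> X ** ctranspose A
          = ctranspose A ** (H ** S + S ** H)"
        by (simp add: H_def matrix_mult.add_right matrix_mul_assoc)
      moreover have "A ** (ctranspose A ** Z) = Z" for Z :: "'a^'n^'n"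
        by (simp add: matrix_mul_assoc O)
      then have "ctranspose A ** Z = 0 \<longleftrightarrow> Z = 0" for Z :: "'a^'n^'n"
        by (metis matrix_mult.zero_right)
      ultimately show ?thesis by simp
    qed
    then show ?thesis
      unfolding S_space_def tangent_space_cartan_model_ctranspose[OF \<sigma> A] V_def by blast
  qed
  have skew: "ctranspose S = - S" if "S \<in> V" for S
    using that by (simp add: V_def generators_def)
  have "subspace V"
    by (rule subspaceI)
      (auto simp: V_def generators_def ctranspose_linear_simps s matrix_ring_simps
        linear_0[of \<sigma>] \<sigma>[unfolded involutive_star_automorphism_def] matrix_mult.zero_left
        matrix_mult.zero_right algebra_simps simp flip: scaleR_add_right)
  then have "subspace (S_space \<sigma> X A)"
    unfolding S_space
    by (intro linear_subspace_image bounded_linear.linear[OF matrix_mult.bounded_linear_right])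
  moreover have sub: "S_space \<sigma> X A \<subseteq> Omega (ctranspose A)"
  proof -
    have "invertible (ctranspose A ** (mat 1 + S))" if "S \<in> V" for S
      using that by (intro invertible_mult invertible_one_plus_skew skew invertible_O_group
          O_group_ctranspose A')
    then show ?thesis by (auto simp: S_space Omega_def matrix_mult.add_right)
  qed
  \<comment> \<open>Pulling \<open>ctranspose A\<close> out of the sum reduces the transform to
    \<open>cay\<close> followed by right multiplication with \<open>A\<close>.\<close>
  moreover have f: "?f (ctranspose A ** S) = cay S ** A" if "S \<in> V" for S
  proof -
    have "ctranspose A + ctranspose A ** S = ctranspose A ** (mat 1 + S)"
      by (simp add: matrix_mult.add_right)
    then show ?thesis
      using invertible_one_plus_skew[OF skew[OF that]] A'(2)
      by (simp add: cayley_def cay_def matrix_inv_mult invertible_O_group matrix_inv_O_group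
          O_group_ctranspose matrix_mul_assoc O)
  qed
  have g: "?g Y = ctranspose A ** cay (Y ** ctranspose A)"
    and inv: "invertible (mat 1 + Y ** ctranspose A)" if "Y \<in> Omega A" for Y
  proof -
    have eq: "mat 1 + Y ** ctranspose A = (A + Y) ** ctranspose A"
      by (simp add: matrix_mult.add_left O)
    show "invertible (mat 1 + Y ** ctranspose A)"
      unfolding eq using that invertible_O_group[OF O_group_ctranspose[OF A'(2)]]
      by (simp add: invertible_mult Omega_def)
    have "matrix_inv ((A + Y) ** ctranspose A) = A ** matrix_inv (A + Y)"
      using that A'(2) by (simp add: matrix_inv_mult invertible_O_group matrix_inv_O_group
          O_group_ctranspose Omega_def)
    then show "?g Y = ctranspose A ** cay (Y ** ctranspose A)"
      by (simp add: cayley_def cay_def eq matrix_mul_assoc matrix_mult.diff_right matrix_mult.diff_left O cancels)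
  qed
  have crit: "cay S ** A \<in> critical_points (height X) (cartan_model \<sigma>) \<longleftrightarrow> S \<in> V"
    if S: "S \<in> generators \<sigma> A" for S
  proof -
    have sk: "ctranspose S = - S" using S by (simp add: generators_def)
    note i = invertible_one_plus_skew[OF sk] invertible_one_minus_skew[OF sk]
    have i': "invertible (mat 1 + (- S))" using i(2) by simp
    have "X_hat \<sigma> X ** ctranspose (cay S ** A) = H ** cay (- S)"
      by (simp add: ctranspose_mult ctranspose_cay i sk H_def matrix_mul_assoc)
    moreover have "cay S ** A ** ctranspose (X_hat \<sigma> X) = cay S ** H"
      by (simp add: H matrix_mul_assoc)
    ultimately have "cay S ** A \<in> critical_points (height X) (cartan_model \<sigma>) \<longleftrightarrow>
        H ** cay (- S) = cay S ** H"
      by (simp add: critical_points_height_iff[OF \<sigma> cartan_model_cay[OF \<sigma> A S]])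
    \<comment> \<open>Intertwining passes from \<open>- S\<close> and \<open>S\<close> to their
      images under \<open>cay\<close>, and back again because \<open>cay\<close> is an
      involution.\<close>
    also have "\<dots> \<longleftrightarrow> H ** (- S) = S ** H"
      using cay_intertwine[OF cay_cay(1)[OF i'] cay_cay(1)[OF i(1)], of H]
        cay_intertwine[OF i' i(1), of H] cay_cay(2)[OF i'] cay_cay(2)[OF i(1)] by metis
    also have "\<dots> \<longleftrightarrow> H ** S + S ** H = 0"
      by (auto simp: matrix_mult.minus_right neg_eq_iff_add_eq_0)
    finally show ?thesis using S by (simp add: V_def)
  qed
  \<comment> \<open>Surjectivity: \<open>cay\<close> of the quotient recovers \<open>S\<close> from
    \<open>Y\<close>, and \<open>cay_quotient_generator\<close> makes it a generator.\<close>
  have fg: "Y = cay S ** A" "S \<in> V" if "Y \<in> ?T" "S = cay (Y ** ctranspose A)" for Y S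
  proof -
    have Y: "Y \<in> Omega A" "Y \<in> symmetric_points \<sigma>"
      using that(1) cartan_model_subset[OF \<sigma>] by auto
    show "Y = cay S ** A" using cay_cay(2)[OF inv[OF Y(1)]] by (simp add: that(2) cancels)
    then show "S \<in> V"
      using crit[of S] that cay_quotient_generator[OF \<sigma> A'(1) Y(2) inv[OF Y(1)]] by auto
  qed
  have f_in: "cay S ** A \<in> ?T" if "S \<in> V" for S
  proof -
    have S: "S \<in> generators \<sigma> A" using that by (simp add: V_def)
    have "invertible ((mat 1 + cay S) ** A)"
      using cay_cay(1)[OF invertible_one_plus_skew[OF skew[OF that]]] invertible_O_group[OF A'(2)]
      by (rule invertible_mult)
    then have "cay S ** A \<in> Omega A" by (simp add: Omega_def matrix_mult.add_left)
    with crit[OF S] that cartan_model_cay[OF \<sigma> A S] show ?thesis by simp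
  qed
  have gf: "?g (cay S ** A) = ctranspose A ** S" if "S \<in> V" for S
    using g[of "cay S ** A"] f_in[OF that] cay_cay(2)[OF invertible_one_plus_skew[OF skew[OF that]]]
    by (simp add: cancels)
  have bij: "bij_betw ?f (S_space \<sigma> X A) ?T"
  proof (rule bij_betw_byWitness[where f' = ?g])
    show "\<forall>\<beta>\<in>S_space \<sigma> X A. ?g (?f \<beta>) = \<beta>" by (auto simp: S_space f gf)
    show "\<forall>Y\<in>?T. ?f (?g Y) = Y"
    proof
      fix Y assume Y: "Y \<in> ?T"
      then have "?g Y = ctranspose A ** cay (Y ** ctranspose A)" using g by blast
      with f[OF fg(2)[OF Y refl]] fg(1)[OF Y refl] show "?f (?g Y) = Y" by simp
    qed
    show "?f ` S_space \<sigma> X A \<subseteq> ?T" using f_in by (auto simp: S_space f)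
    show "?g ` ?T \<subseteq> S_space \<sigma> X A"
    proof (rule image_subsetI)
      fix Y assume Y: "Y \<in> ?T"
      then have "?g Y = ctranspose A ** cay (Y ** ctranspose A)" using g by blast
      with fg(2)[OF Y refl] show "?g Y \<in> S_space \<sigma> X A" by (simp add: S_space)
    qed
  qed
  \<comment> \<open>The abstract inverse agrees on the target with \<open>cayley A\<close>, an
    explicit smooth map on the open set \<open>Omega A\<close>.\<close>
  have "inv_into (S_space \<sigma> X A) ?f Y = ?g Y" if Y: "Y \<in> ?T" for Y
  proof -
    obtain S where S: "S \<in> V" "Y = cay S ** A" using fg[OF Y refl] by blast
    then show ?thesis
      using inv_into_f_f[OF bij_betw_imp_inj_on[OF bij], of "ctranspose A ** S"]
      by (simp add: S_space f gf)
  qed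
  then have "smooth_map_on ?T (inv_into (S_space \<sigma> X A) ?f)"
    by (intro smooth_map_on_cong[OF smooth_map_onI[OF open_Omega _ Ck_on_cayley]]) auto
  moreover have "smooth_map_on (S_space \<sigma> X A) ?f"
    by (rule smooth_map_onI[OF open_Omega sub Ck_on_cayley])
  ultimately show ?thesis using bij by (simp add: diffeomorphism_def)
qed

end
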